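(* Let $n\ge1$, let $L,\bar M\in\mathbb{R}^{n\times n}$, let $M\in\mathbb{R}^{n\times n}$ be diagonal with positive diagonal entries, let $\mathcal I\subseteq\{1,\dots,n\}$ and $\mathcal A=\{1,\dots,n\}\setminus\mathcal I$, and let $\alpha>0$ be such that $\sqrt\alpha L+\bar M\Pi_{\mathcal I}$ is nonsingular. Let $$\zeta=\left\|M^{\frac12}\left(\sqrt{\alpha}L+\bar M\Pi_{\mathcal I}\right)^{-1}\sqrt{\alpha}\,L\,M^{-\frac12}\right\|,\qquad \xi=\zeta^2+(1+\zeta)^2 ,$$ and let $J^{aug}$, $J^{red}$, $\mathcal P_{aug}^{BDF}$, $\mathcal P_{red}^{BDF}$ be the matrices defined in the context. i) The eigenvalues of $(\mathcal P_{aug}^{BDF})^{-1}J^{aug}$ belong to $I^-\cup I^+$ with $$I^-=\left[\frac{1-\sqrt{1+4\xi}}2,\ \frac{1-\sqrt3}2\right],\qquad I^+=\left[1,\ \frac{1+\sqrt{1+4\xi}}2\right].$$ ii) The eigenvalues of $(\mathcal P_{red}^{BDF})^{-1}J^{red}$ belong to $I^-\cup I^+$ with $$I^-=\left[\frac{-\xi+1-\sqrt{(\xi+1)^2+4\zeta^2}}2,\ \frac{1-\sqrt3}2\right],\qquad I^+=\left[1,\ \frac{1+\sqrt{1+4\zeta^2}}2\right].$$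
   Context: For an index set $\mathcal C\subseteq\{1,\dots,n\}$, $\Pi_{\mathcal C}\in\mathbb{R}^{n\times n}$ is the diagonal $0/1$ matrix with ones exactly at the indices in $\mathcal C$, and $P_{\mathcal C}\in\mathbb{R}^{|\mathcal C|\times n}$ consists of the rows of $\Pi_{\mathcal C}$ with indices in $\mathcal C$ (so $P_{\mathcal C}^TP_{\mathcal C}=\Pi_{\mathcal C}$). $\|\cdot\|$ is the spectral norm. The augmented and reduced matrices are $$J^{aug}=\begin{bmatrix}M&0&L^T&0\\0&\alpha M&-\bar M^T&MP_{\mathcal A}^T\\L&-\bar M&0&0\\0&P_{\mathcal A}M&0&0\end{bmatrix},\qquad J^{red}=\begin{bmatrix}M&L^T\\L&-\frac1\alpha\bar MM^{-1}\Pi_{\mathcal I}\bar M^T\end{bmatrix}.$$ Let $$\widehat{\mathbb S}=(\sqrt\alpha L+\bar M\Pi_{\mathcal I})M^{-1}(\sqrt\alpha L+\bar M\Pi_{\mathcal I})^T,$$ $$\widehat S=\frac1\alpha\begin{bmatrix}I&-\bar M\Pi_{\mathcal A}M^{-1}P_{\mathcal A}^T\\0&I\end{bmatrix}\begin{bmatrix}\widehat{\mathbb S}&0\\0&P_{\mathcal A}MP_{\mathcal A}^T\end{bmatrix}\begin{bmatrix}I&-\bar M\Pi_{\mathcal A}M^{-1}P_{\mathcal A}^T\\0&I\end{bmatrix}^T.$$ The block diagonal preconditioners are $$\mathcal P_{aug}^{BDF}=\begin{bmatrix}J_{11}&0\\0&\widehat S\end{bmatrix},\quad J_{11}=\begin{bmatrix}M&0\\0&\alpha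 M\end{bmatrix},\qquad \mathcal P_{red}^{BDF}=\begin{bmatrix}M&0\\0&\frac1\alpha\widehat{\mathbb S}\end{bmatrix}.$$ *)

theory Defs
  imports
    Complex_Main
    "Jordan_Normal_Form.Gauss_Jordan_Elimination"
    "Jordan_Normal_Form.DL_Submatrix"
    "Jordan_Normal_Form.Spectral_Radius"
begin

text \<open>Rows and columns are numbered from 0, so index sets are subsets of \<open>{0..<n}\<close>.\<close>

text \<open>Meaningful for invertible matrices only.\<close>
definition minv :: "'a::field mat \<Rightarrow> 'a mat" where
  "minv A = the (mat_inverse A)"

text \<open>The square root of a diagonal matrix with nonnegative diagonal.\<close>
definition diag_sqrt :: "real mat \<Rightarrow> real mat" where
  "diag_sqrt D = mat_diag (dim_row D) (\<lambda>i. sqrt (D $$ (i, i)))"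

definition euclid_norm :: "real vec \<Rightarrow> real" where
  "euclid_norm v = sqrt (v \<bullet> v)"

text \<open>The operator norm induced by the Euclidean norm; the supremum is over a nonempty
  bounded set (in every dimension).\<close>
definition spectral_norm :: "real mat \<Rightarrow> real" where
  "spectral_norm A =
     Sup {euclid_norm (A *\<^sub>v v) | v. v \<in> carrier_vec (dim_col A) \<and> euclid_norm v \<le> 1}"

definition Pi_mat :: "nat \<Rightarrow> nat set \<Rightarrow> real mat" where
  "Pi_mat n C = mat_diag n (\<lambda>i. if i \<in> C then 1 else 0)"

definition P_mat :: "nat \<Rightarrow> nat set \<Rightarrow> real mat" where
  "P_mat n C = submatrix (Pi_mat n C) C UNIV"

text \<open>In the following, \<open>L\<close>, \<open>Mb\<close> (the paper's \<open>M\<close> with a bar) and \<open>M\<close> are \<open>n \<times> n\<close> matrices,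
  \<open>\<I>\<close> and \<open>\<A>\<close> are complementary subsets of \<open>{0..<n}\<close>. The case \<open>\<A> = {}\<close> is allowed: the
  corresponding blocks then have zero rows or columns.\<close>

definition block_diag2 :: "real mat \<Rightarrow> real mat \<Rightarrow> real mat" where
  "block_diag2 A D =
     four_block_mat A (0\<^sub>m (dim_row A) (dim_col D)) (0\<^sub>m (dim_row D) (dim_col A)) D"

definition J11 :: "real \<Rightarrow> real mat \<Rightarrow> real mat" where
  "J11 \<alpha> M = block_diag2 M (\<alpha> \<cdot>\<^sub>m M)"

definition J_aug :: "nat \<Rightarrow> real \<Rightarrow> real mat \<Rightarrow> real mat \<Rightarrow> real mat \<Rightarrow> nat set \<Rightarrow> real mat" where
  "J_aug n \<alpha> L Mb M \<A> =
     four_block_mat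
       (four_block_mat
          M             (0\<^sub>m n n)
          (0\<^sub>m n n)    (\<alpha> \<cdot>\<^sub>m M))
       (four_block_mat
          (transpose_mat L)       (0\<^sub>m n (card \<A>))
          (- transpose_mat Mb)    (M * transpose_mat (P_mat n \<A>)))
       (four_block_mat
          L                    (- Mb)
          (0\<^sub>m (card \<A>) n)   (P_mat n \<A> * M))
       (four_block_mat
          (0\<^sub>m n n)           (0\<^sub>m n (card \<A>))
          (0\<^sub>m (card \<A>) n)   (0\<^sub>m (card \<A>) (card \<A>)))"

definition J_red :: "nat \<Rightarrow> real \<Rightarrow> real mat \<Rightarrow> real mat \<Rightarrow> real mat \<Rightarrow> nat set \<Rightarrow> real mat" where
  "J_red n \<alpha> L Mb M \<I> =
     four_block_mat
       M   (transpose_mat L)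
       L   (- ((1 / \<alpha>) \<cdot>\<^sub>m (Mb * minv M * Pi_mat n \<I> * transpose_mat Mb)))"

definition SS_hat :: "nat \<Rightarrow> real \<Rightarrow> real mat \<Rightarrow> real mat \<Rightarrow> real mat \<Rightarrow> nat set \<Rightarrow> real mat" where
  "SS_hat n \<alpha> L Mb M \<I> =
     (sqrt \<alpha> \<cdot>\<^sub>m L + Mb * Pi_mat n \<I>) * minv M *
       transpose_mat (sqrt \<alpha> \<cdot>\<^sub>m L + Mb * Pi_mat n \<I>)"

definition S_hat ::
  "nat \<Rightarrow> real \<Rightarrow> real mat \<Rightarrow> real mat \<Rightarrow> real mat \<Rightarrow> nat set \<Rightarrow> nat set \<Rightarrow> real mat" where
  "S_hat n \<alpha> L Mb M \<I> \<A> =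
     (let U = four_block_mat
                (1\<^sub>m n)
                (- (Mb * Pi_mat n \<A> * minv M * transpose_mat (P_mat n \<A>)))
                (0\<^sub>m (card \<A>) n)
                (1\<^sub>m (card \<A>))
      in (1 / \<alpha>) \<cdot>\<^sub>m
           (U * block_diag2 (SS_hat n \<alpha> L Mb M \<I>)
                  (P_mat n \<A> * M * transpose_mat (P_mat n \<A>)) *
            transpose_mat U))"

definition P_aug_BDF ::
  "nat \<Rightarrow> real \<Rightarrow> real mat \<Rightarrow> real mat \<Rightarrow> real mat \<Rightarrow> nat set \<Rightarrow> nat set \<Rightarrow> real mat" where
  "P_aug_BDF n \<alpha> L Mb M \<I> \<A> = block_diag2 (J11 \<alpha> M) (S_hat n \<alpha> L Mb M \<I> \<A>)"

definition P_red_BDF ::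
  "nat \<Rightarrow> real \<Rightarrow> real mat \<Rightarrow> real mat \<Rightarrow> real mat \<Rightarrow> nat set \<Rightarrow> real mat" where
  "P_red_BDF n \<alpha> L Mb M \<I> = block_diag2 M ((1 / \<alpha>) \<cdot>\<^sub>m SS_hat n \<alpha> L Mb M \<I>)"

end

theory Submission
  imports Defs "HOL-Analysis.L2_Norm"
begin

text \<open>
  Both preconditioned matrices have the form \<open>P\<^sup>-\<^sup>1 J\<close> with \<open>J = [A, B\<^sup>T; B, -C]\<close> symmetric and
  \<open>P = diag(A, S)\<close> symmetric positive definite, so an eigenvalue is a real \<open>l\<close> with a real \<open>v \<noteq> 0\<close>
  such that \<open>J v = l P v\<close> (\<open>generalized_symmetric_eigenvalue_real\<close>). If \<open>l \<noteq> 1\<close>, the first block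
  row determines the first component of \<open>v\<close> by the second one, \<open>y\<close>, and the second block row,
  tested with \<open>y\<close>, becomes a scalar equation
    \<open>y \<bullet> B A\<^sup>-\<^sup>1 B\<^sup>T y = (l - 1) (l (y \<bullet> S y) + y \<bullet> C y)\<close>
  (\<open>preconditioned_saddle_point_eigenvalue\<close>). Everything then rests on comparing three quadratic
  forms.

  Put \<open>W = sqrt \<alpha> L + Mb \<Pi>\<^sub>I\<close> and let \<open>\<parallel>a\<parallel>\<^sup>2 = \<Sum>i. a\<^sub>i\<^sup>2 / M\<^sub>i\<^sub>i\<close>. With
  \<open>f = \<parallel>sqrt \<alpha> L\<^sup>T y\<parallel>\<^sup>2\<close>, \<open>g = \<parallel>\<Pi>\<^sub>I Mb\<^sup>T y\<parallel>\<^sup>2\<close>, \<open>h = \<parallel>W\<^sup>T y\<parallel>\<^sup>2\<close> there are the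
  inequalities
    \<open>f \<le> \<zeta>\<^sup>2 h\<close>, \<open>g \<le> (1 + \<zeta>)\<^sup>2 h\<close>, \<open>h \<le> 2 (f + g)\<close>:
  the first because \<open>\<zeta>\<close> is the spectral norm of a matrix whose transpose maps \<open>M\<^sup>-\<^sup>1\<^sup>/\<^sup>2 W\<^sup>T y\<close> to
  \<open>M\<^sup>-\<^sup>1\<^sup>/\<^sup>2 sqrt \<alpha> L\<^sup>T y\<close>, and a matrix and its transpose have the same norm. As
  \<open>W\<^sup>T y\<close> is the sum of the vectors in \<open>f\<close> and \<open>g\<close>, the second follows by the triangle
  inequality and the third from \<open>(a + b)\<^sup>2 \<le> 2 (a\<^sup>2 + b\<^sup>2)\<close>.

  For the reduced matrix the scalar equation is \<open>f = (l - 1) (l h + g)\<close>, and elementary estimates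
  give the intervals (\<open>red_eigenvalue_range\<close>). For the augmented matrix \<open>C = 0\<close>, and the Schur
  complement and \<open>S\<close> are the same congruence transform of block diagonal matrices with the same
  second block. Up to the factor \<open>1 / \<alpha>\<close> their quadratic forms are therefore \<open>f + g + w\<close> and
  \<open>h + w\<close> with a common \<open>w \<ge> 0\<close>, where \<open>f\<close>, \<open>g\<close>, \<open>h\<close> are taken at the first component of \<open>y\<close>, so \<open>l (l - 1)\<close> lies in \<open>[1/2, \<xi>]\<close> because \<open>\<xi> \<ge> 1\<close>
  (\<open>aug_eigenvalue_range\<close>).
\<close>

section \<open>Inverses, diagonal matrices and block matrices\<close>

lemma minv_inverse:
  fixes A :: "real mat"
  assumes A: "A \<in> carrier_mat n n" and d: "det A \<noteq> 0"
  shows "minv A \<in> carrier_mat n n" "A * minv A = 1\<^sub>m n" "minv A * A = 1\<^sub>m n"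
proof -
  obtain B where B: "mat_inverse A = Some B"
    using mat_inverse(1)[OF A] det_non_zero_imp_unit[OF A d] by fastforce
  then have "minv A = B"
    unfolding minv_def by simp
  with mat_inverse(2)[OF A B]
  show "minv A \<in> carrier_mat n n" "A * minv A = 1\<^sub>m n" "minv A * A = 1\<^sub>m n"
    by auto
qed

lemma minv_unique:
  fixes A B :: "real mat"
  assumes A: "A \<in> carrier_mat n n" and B: "B \<in> carrier_mat n n" and AB: "A * B = 1\<^sub>m n"
  shows "minv A = B"
proof -
  have "det A * det B = 1"
    using det_mult[OF A B] AB by simp
  then have "det A \<noteq> 0"
    by auto
  note i = minv_inverse[OF A this]
  have "minv A = minv A * (A * B)"
    using i(1) AB by simp
  also have "\<dots> = minv A * A * B"
    using i(1) A B by (simp add: assoc_mult_mat[of _ n n _ n _ n])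
  also have "\<dots> = B"
    using i(3) B by simp
  finally show ?thesis .
qed

lemma invertible_mat_det_nonzero:
  fixes A :: "real mat"
  assumes A: "A \<in> carrier_mat n n" and inv: "invertible_mat A"
  shows "det A \<noteq> 0"
proof -
  obtain B where AB: "A * B = 1\<^sub>m n" and BA: "B * A = 1\<^sub>m (dim_row B)"
    using inv A unfolding invertible_mat_def inverts_mat_def by auto
  have "dim_col B = n"
    using arg_cong[OF AB, of dim_col] by simp
  moreover have "dim_row B = n"
    using arg_cong[OF BA, of dim_col] A by simp
  ultimately have "B \<in> carrier_mat n n"
    by auto
  then have "det A * det B = 1"
    using det_mult[OF A] AB by (metis det_one)
  then show ?thesis
    by auto
qed

lemma mat_diag_mult_vec:
  fixes d :: "nat \<Rightarrow> 'a::semiring_0"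
  assumes "v \<in> carrier_vec n"
  shows "mat_diag n d *\<^sub>v v = vec n (\<lambda>i. d i * v $ i)"
proof (rule eq_vecI)
  fix i assume "i < dim_vec (vec n (\<lambda>i. d i * v $ i))"
  then have i: "i < n" by simp
  have "(mat_diag n d *\<^sub>v v) $ i = (\<Sum>j = 0..<n. (if i = j then d j else 0) * v $ j)"
    using i assms unfolding mat_diag_def scalar_prod_def by (auto simp: scalar_prod_def)
  also have "\<dots> = (\<Sum>j = 0..<n. if j = i then d j * v $ j else 0)"
    by (rule sum.cong) auto
  also have "\<dots> = d i * v $ i"
    using i by (simp add: sum.delta)
  finally show "(mat_diag n d *\<^sub>v v) $ i = vec n (\<lambda>i. d i * v $ i) $ i"
    using i by simp
qed (auto simp: mat_diag_def)

lemma transpose_mat_diag [simp]: "transpose_mat (mat_diag n d) = mat_diag n d"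
  by (rule eq_matI) (auto simp: mat_diag_def)

lemma mat_diag_quadratic_form:
  fixes d :: "nat \<Rightarrow> real"
  assumes "v \<in> carrier_vec n"
  shows "v \<bullet> (mat_diag n d *\<^sub>v v) = (\<Sum>i = 0..<n. d i * (v $ i)\<^sup>2)"
  using assms unfolding mat_diag_mult_vec[OF assms]
  by (auto simp: scalar_prod_def power2_eq_square intro!: sum.cong)

lemma diagonal_mat_eq_mat_diag:
  assumes "D \<in> carrier_mat n n" and "diagonal_mat D"
  shows "D = mat_diag n (\<lambda>i. D $$ (i, i))"
  using assms by (intro eq_matI) (auto simp: mat_diag_def diagonal_mat_def)

lemma minv_mat_diag:
  fixes d :: "nat \<Rightarrow> real"
  assumes "\<And>i. i < n \<Longrightarrow> d i \<noteq> 0"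
  shows "minv (mat_diag n d) = mat_diag n (\<lambda>i. 1 / d i)"
proof (rule minv_unique)
  show "mat_diag n d * mat_diag n (\<lambda>i. 1 / d i) = 1\<^sub>m n"
    unfolding mat_diag_diag using assms by (intro eq_matI) (auto simp: mat_diag_def)
qed auto

lemma append_vec_cases:
  assumes "v \<in> carrier_vec (n + m)"
  obtains v1 v2 where "v1 \<in> carrier_vec n" "v2 \<in> carrier_vec m" "v = v1 @\<^sub>v v2"
  using assms vec_first_last_append[OF assms] by (metis vec_first_carrier vec_last_carrier)

lemma congruence_symmetric:
  fixes A B :: "real mat"
  assumes Ac: "A \<in> carrier_mat k k" and B: "B \<in> carrier_mat n k" and At: "transpose_mat A = A"
  shows "transpose_mat (B * A * transpose_mat B) = B * A * transpose_mat B"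
proof -
  have "transpose_mat (B * A * transpose_mat B) = B * (transpose_mat A * transpose_mat B)"
    using Ac B by (simp add: assoc_mult_mat[of _ n k _ k _ n] transpose_mult[of _ n k _ n] transpose_mult[of _ k k _ n]
      assoc_mult_mat[of _ n k _ k _ n])
  also have "\<dots> = B * A * transpose_mat B"
    using Ac B At by (simp add: assoc_mult_mat[of _ n k _ k _ n])
  finally show ?thesis .
qed

lemma congruence_quadratic_form:
  fixes A B :: "real mat"
  assumes A: "A \<in> carrier_mat k k" and B: "B \<in> carrier_mat n k" and v: "v \<in> carrier_vec n"
  shows "v \<bullet> (B * A * transpose_mat B *\<^sub>v v)
    = (transpose_mat B *\<^sub>v v) \<bullet> (A *\<^sub>v (transpose_mat B *\<^sub>v v))"
proof -
  have w: "transpose_mat B *\<^sub>v v \<in> carrier_vec k"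
    using B v by (auto intro!: mult_mat_vec_carrier[of _ k n])
  have "B * A * transpose_mat B *\<^sub>v v = B *\<^sub>v (A *\<^sub>v (transpose_mat B *\<^sub>v v))"
    using A B v
    using assoc_mult_mat_vec[OF mult_carrier_mat[OF B A] transpose_carrier_mat[THEN iffD2, OF B] v]
      assoc_mult_mat_vec[OF B A w] by simp
  moreover have "A *\<^sub>v (transpose_mat B *\<^sub>v v) \<in> carrier_vec k"
    using A w by (rule mult_mat_vec_carrier)
  ultimately show ?thesis
    using transpose_vec_mult_scalar[OF B _ v] by metis
qed

lemma block_diag2_carrier:
  assumes "A \<in> carrier_mat n n" and "D \<in> carrier_mat m m"
  shows "block_diag2 A D \<in> carrier_mat (n + m) (n + m)"
  using assms unfolding block_diag2_def by (intro four_block_carrier_mat) auto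

lemma block_diag2_mult_vec:
  assumes "A \<in> carrier_mat n n" and "D \<in> carrier_mat m m"
    and "a \<in> carrier_vec n" and "d \<in> carrier_vec m"
  shows "block_diag2 A D *\<^sub>v (a @\<^sub>v d) = (A *\<^sub>v a) @\<^sub>v (D *\<^sub>v d)"
  using mult_mat_vec_split[OF assms] assms(1,2) unfolding block_diag2_def by auto

lemma block_diag2_quadratic_form:
  assumes "A \<in> carrier_mat n n" and "D \<in> carrier_mat m m"
    and "a \<in> carrier_vec n" and "d \<in> carrier_vec m"
  shows "(a @\<^sub>v d) \<bullet> (block_diag2 A D *\<^sub>v (a @\<^sub>v d)) = a \<bullet> (A *\<^sub>v a) + d \<bullet> (D *\<^sub>v d)"
  unfolding block_diag2_mult_vec[OF assms]
  using assms by (intro scalar_prod_append) (auto intro!: mult_mat_vec_carrier)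

lemma smult_mat_mult_vec:
  fixes A :: "'a::comm_ring mat"
  assumes "A \<in> carrier_mat n m" and "v \<in> carrier_vec m"
  shows "(c \<cdot>\<^sub>m A) *\<^sub>v v = c \<cdot>\<^sub>v (A *\<^sub>v v)"
  using assms by (intro eq_vecI) (auto simp: row_smult)

lemma zero_mat_mult_vec:
  fixes v :: "'a::semiring_0 vec"
  assumes "v \<in> carrier_vec m"
  shows "0\<^sub>m n m *\<^sub>v v = 0\<^sub>v n"
  using assms by (intro eq_vecI) auto

lemma smult_quadratic_form:
  fixes A :: "real mat"
  assumes "A \<in> carrier_mat n n" and "v \<in> carrier_vec n"
  shows "v \<bullet> ((c \<cdot>\<^sub>m A) *\<^sub>v v) = c * (v \<bullet> (A *\<^sub>v v))"
  using assms by (simp add: smult_mat_mult_vec[OF assms])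

lemma transpose_smult_mat: "transpose_mat (c \<cdot>\<^sub>m A) = c \<cdot>\<^sub>m transpose_mat A"
  by (rule eq_matI) auto


section \<open>Positive definite matrices\<close>

definition pos_def_mat :: "nat \<Rightarrow> real mat \<Rightarrow> bool" where
  "pos_def_mat n A \<longleftrightarrow> A \<in> carrier_mat n n \<and> transpose_mat A = A \<and>
     (\<forall>v \<in> carrier_vec n. v \<noteq> 0\<^sub>v n \<longrightarrow> v \<bullet> (A *\<^sub>v v) > 0)"

lemma pos_def_mat_nonneg:
  assumes "pos_def_mat n A" and "v \<in> carrier_vec n"
  shows "v \<bullet> (A *\<^sub>v v) \<ge> 0"
proof (cases "v = 0\<^sub>v n")
  case True
  then have "A *\<^sub>v v \<in> carrier_vec n"
    using assms unfolding pos_def_mat_def by (auto intro!: mult_mat_vec_carrier)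
  with True show ?thesis by simp
next
  case False
  then show ?thesis using assms unfolding pos_def_mat_def by fastforce
qed

lemma pos_def_mat_det_nonzero:
  assumes "pos_def_mat n A"
  shows "det A \<noteq> 0"
proof
  assume "det A = 0"
  moreover have A: "A \<in> carrier_mat n n"
    using assms unfolding pos_def_mat_def by simp
  ultimately obtain v where v: "v \<in> carrier_vec n" "v \<noteq> 0\<^sub>v n" "A *\<^sub>v v = 0\<^sub>v n"
    using det_0_iff_vec_prod_zero by blast
  then have "v \<bullet> (A *\<^sub>v v) = 0" by simp
  with v assms show False unfolding pos_def_mat_def by fastforce
qed

lemma pos_def_mat_diag:
  assumes "\<And>i. i < n \<Longrightarrow> d i > 0"
  shows "pos_def_mat n (mat_diag n d)"
  unfolding pos_def_mat_def
proof (intro conjI ballI impI)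
  fix v :: "real vec"
  assume v: "v \<in> carrier_vec n" "v \<noteq> 0\<^sub>v n"
  then obtain k where "k < n" "v $ k \<noteq> 0"
    by (metis carrier_vecD eq_vecI index_zero_vec)
  then have "(\<Sum>i = 0..<n. d i * (v $ i)\<^sup>2) > 0"
    using assms by (intro sum_pos2[of _ k]) (auto simp: less_imp_le)
  then show "v \<bullet> (mat_diag n d *\<^sub>v v) > 0"
    using v by (simp add: mat_diag_quadratic_form)
qed auto

lemma pos_def_mat_smult:
  assumes "pos_def_mat n A" and "c > 0"
  shows "pos_def_mat n (c \<cdot>\<^sub>m A)"
proof -
  have A: "A \<in> carrier_mat n n" using assms unfolding pos_def_mat_def by simp
  show ?thesis
    using assms A smult_quadratic_form[OF A] unfolding pos_def_mat_def
    by (auto simp: transpose_smult_mat)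
qed

text \<open>The matrix \<open>B\<close> may be rectangular; this is what makes the form \<open>P M P\<^sup>T\<close> of a selection of rows
  accessible.\<close>

lemma pos_def_mat_congruence:
  assumes A: "pos_def_mat k A" and B: "B \<in> carrier_mat n k"
    and inj: "\<And>v. v \<in> carrier_vec n \<Longrightarrow> transpose_mat B *\<^sub>v v = 0\<^sub>v k \<Longrightarrow> v = 0\<^sub>v n"
  shows "pos_def_mat n (B * A * transpose_mat B)"
proof -
  have Ac: "A \<in> carrier_mat k k" and At: "transpose_mat A = A"
    using A unfolding pos_def_mat_def by auto
  have sym: "transpose_mat (B * A * transpose_mat B) = B * A * transpose_mat B"
    using Ac B At by (rule congruence_symmetric)
  show ?thesis
    unfolding pos_def_mat_def
  proof (intro conjI ballI impI)
    fix v :: "real vec" assume v: "v \<in> carrier_vec n" "v \<noteq> 0\<^sub>v n"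
    have "transpose_mat B *\<^sub>v v \<in> carrier_vec k"
      using B v by (auto intro!: mult_mat_vec_carrier[of _ k n])
    then show "v \<bullet> (B * A * transpose_mat B *\<^sub>v v) > 0"
      unfolding congruence_quadratic_form[OF Ac B v(1)]
      using A inj[OF v(1)] v(2) unfolding pos_def_mat_def by blast
  qed (use sym Ac B in auto)
qed

lemma pos_def_mat_block_diag2:
  assumes A: "pos_def_mat n A" and D: "pos_def_mat m D"
  shows "pos_def_mat (n + m) (block_diag2 A D)"
proof -
  have c: "A \<in> carrier_mat n n" "D \<in> carrier_mat m m"
    and t: "transpose_mat A = A" "transpose_mat D = D"
    using A D unfolding pos_def_mat_def by auto
  show ?thesis
    unfolding pos_def_mat_def
  proof (intro conjI ballI impI)
    show "block_diag2 A D \<in> carrier_mat (n + m) (n + m)"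
      using c by (rule block_diag2_carrier)
    show "transpose_mat (block_diag2 A D) = block_diag2 A D"
      using c t unfolding block_diag2_def by (subst transpose_four_block_mat) auto
    fix v :: "real vec" assume v: "v \<in> carrier_vec (n + m)" "v \<noteq> 0\<^sub>v (n + m)"
    obtain a d where ad: "a \<in> carrier_vec n" "d \<in> carrier_vec m" "v = a @\<^sub>v d"
      using append_vec_cases[OF v(1)] .
    have "0\<^sub>v n @\<^sub>v 0\<^sub>v m = (0\<^sub>v (n + m) :: real vec)"
      by (rule eq_vecI) auto
    then have "a \<noteq> 0\<^sub>v n \<or> d \<noteq> 0\<^sub>v m"
      using v ad by auto
    moreover have "a \<bullet> (A *\<^sub>v a) \<ge> 0" "d \<bullet> (D *\<^sub>v d) \<ge> 0"
      using pos_def_mat_nonneg A D ad by auto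
    moreover have "a \<noteq> 0\<^sub>v n \<Longrightarrow> a \<bullet> (A *\<^sub>v a) > 0" "d \<noteq> 0\<^sub>v m \<Longrightarrow> d \<bullet> (D *\<^sub>v d) > 0"
      using A D ad unfolding pos_def_mat_def by auto
    ultimately show "v \<bullet> (block_diag2 A D *\<^sub>v v) > 0"
      unfolding ad(3) block_diag2_quadratic_form[OF c ad(1,2)] by linarith
  qed
qed

section \<open>Eigenvalues of preconditioned saddle point matrices\<close>

lemma map_vec_Re_Im_mult:
  assumes A: "A \<in> carrier_mat n m" and w: "w \<in> carrier_vec m"
  shows "map_vec Re (map_mat complex_of_real A *\<^sub>v w) = A *\<^sub>v map_vec Re w"
    and "map_vec Im (map_mat complex_of_real A *\<^sub>v w) = A *\<^sub>v map_vec Im w"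
  using A w by (auto intro!: eq_vecI sum.cong simp: scalar_prod_def)

text \<open>Splitting a complex eigenvector into \<open>a + \<i> b\<close> and the eigenvalue into \<open>p + \<i> q\<close> gives
  \<open>J a = p P a - q P b\<close> and \<open>J b = p P b + q P a\<close>. By symmetry \<open>b \<bullet> J a = a \<bullet> J b\<close>, so
  \<open>q (a \<bullet> P a + b \<bullet> P b) = 0\<close>, and positive definiteness forces \<open>q = 0\<close>. Then \<open>a\<close> and \<open>b\<close> both
  solve the real equation and one of them is nonzero.\<close>

lemma generalized_symmetric_eigenvalue_real:
  assumes P: "pos_def_mat n P" and J: "J \<in> carrier_mat n n" and Jt: "transpose_mat J = J"
    and ev: "z \<in> spectrum (map_mat complex_of_real (minv P * J))"
  obtains p v where "z = complex_of_real p" "v \<in> carrier_vec n" "v \<noteq> 0\<^sub>v n"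
    "J *\<^sub>v v = p \<cdot>\<^sub>v (P *\<^sub>v v)"
proof -
  have Pc: "P \<in> carrier_mat n n" and Pt: "transpose_mat P = P"
    using P unfolding pos_def_mat_def by auto
  note inv = minv_inverse[OF Pc pos_def_mat_det_nonzero[OF P]]
  define A where "A = minv P * J"
  have A: "A \<in> carrier_mat n n"
    unfolding A_def using inv(1) J by simp
  have PA: "P * A = J"
    unfolding A_def using inv Pc J by (simp add: assoc_mult_mat[of _ n n _ n _ n, symmetric])
  obtain w where w: "w \<in> carrier_vec n" "w \<noteq> 0\<^sub>v n"
    "map_mat complex_of_real A *\<^sub>v w = z \<cdot>\<^sub>v w"
    using ev A unfolding spectrum_def eigenvalue_def eigenvector_def A_def[symmetric] by auto
  define a b p q where "a = map_vec Re w" and "b = map_vec Im w" and "p = Re z" and "q = Im z"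
  have ab: "a \<in> carrier_vec n" "b \<in> carrier_vec n"
    using w unfolding a_def b_def by auto
  have "A *\<^sub>v a = map_vec Re (z \<cdot>\<^sub>v w)" "A *\<^sub>v b = map_vec Im (z \<cdot>\<^sub>v w)"
    using map_vec_Re_Im_mult[OF A w(1)] w(3) unfolding a_def b_def by auto
  then have Aa: "A *\<^sub>v a = p \<cdot>\<^sub>v a - q \<cdot>\<^sub>v b" and Ab: "A *\<^sub>v b = p \<cdot>\<^sub>v b + q \<cdot>\<^sub>v a"
    using w(1) unfolding a_def b_def p_def q_def by (auto intro!: eq_vecI)
  define Pa Pb where "Pa = P *\<^sub>v a" and "Pb = P *\<^sub>v b"
  have Pab: "Pa \<in> carrier_vec n" "Pb \<in> carrier_vec n"
    using Pc ab unfolding Pa_def Pb_def by auto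
  have Ja: "J *\<^sub>v a = p \<cdot>\<^sub>v Pa - q \<cdot>\<^sub>v Pb"
    using assoc_mult_mat_vec[OF Pc A ab(1)] ab Pc unfolding PA Aa Pa_def Pb_def
    by (simp add: mult_minus_distrib_mat_vec[of _ n n] mult_mat_vec[of _ n n])
  have Jb: "J *\<^sub>v b = p \<cdot>\<^sub>v Pb + q \<cdot>\<^sub>v Pa"
    using assoc_mult_mat_vec[OF Pc A ab(2)] ab Pc unfolding PA Ab Pa_def Pb_def
    by (simp add: mult_add_distrib_mat_vec[of _ n n] mult_mat_vec[of _ n n])
  have "b \<bullet> (J *\<^sub>v a) = a \<bullet> (J *\<^sub>v b)"
    using transpose_vec_mult_scalar[OF J ab] ab J unfolding Jt
    by (metis comm_scalar_prod mult_mat_vec_carrier)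
  moreover have "b \<bullet> (J *\<^sub>v a) = p * (b \<bullet> Pa) - q * (b \<bullet> Pb)"
    unfolding Ja using ab Pab by (simp add: scalar_prod_minus_distrib[of _ n])
  moreover have "a \<bullet> (J *\<^sub>v b) = p * (a \<bullet> Pb) + q * (a \<bullet> Pa)"
    unfolding Jb using ab Pab by (simp add: scalar_prod_add_distrib[of _ n])
  moreover have "b \<bullet> Pa = a \<bullet> Pb"
    using transpose_vec_mult_scalar[OF Pc ab] ab Pc Pab unfolding Pt Pa_def Pb_def
    by (metis comm_scalar_prod)
  ultimately have "q * (a \<bullet> Pa + b \<bullet> Pb) = 0"
    by (simp add: algebra_simps)
  moreover have ab0: "a \<noteq> 0\<^sub>v n \<or> b \<noteq> 0\<^sub>v n"
  proof (rule ccontr)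
    assume "\<not> ?thesis"
    then have "Re (w $ i) = 0" "Im (w $ i) = 0" if "i < n" for i
      using that w(1) unfolding a_def b_def by (metis carrier_vecD index_map_vec(1) index_zero_vec(1))+
    then have "w = 0\<^sub>v n"
      using w(1) by (intro eq_vecI) (auto simp: complex_eq_iff)
    with w show False by simp
  qed
  have "a \<bullet> Pa \<ge> 0" "b \<bullet> Pb \<ge> 0" "a \<noteq> 0\<^sub>v n \<Longrightarrow> a \<bullet> Pa > 0" "b \<noteq> 0\<^sub>v n \<Longrightarrow> b \<bullet> Pb > 0"
    using pos_def_mat_nonneg[OF P] P ab unfolding Pa_def Pb_def pos_def_mat_def by auto
  with ab0 have "a \<bullet> Pa + b \<bullet> Pb > 0"
    by linarith
  ultimately have q: "q = 0" by simp
  then have "J *\<^sub>v a = p \<cdot>\<^sub>v (P *\<^sub>v a)" "J *\<^sub>v b = p \<cdot>\<^sub>v (P *\<^sub>v b)"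
    using Ja Jb Pab unfolding Pa_def Pb_def by (auto intro!: eq_vecI)
  moreover have "z = complex_of_real p"
    using q unfolding p_def q_def by (simp add: complex_eq_iff)
  ultimately show thesis
    using that ab ab0 by metis
qed

text \<open>For \<open>v = (x, y)\<close> the vector \<open>t\<close> is \<open>(l - 1) x\<close>, so that the first block row reads \<open>A t = B\<^sup>T y\<close>. Then
  \<open>t \<bullet> A t\<close> is the form \<open>y \<bullet> B A\<^sup>-\<^sup>1 B\<^sup>T y\<close> of the Schur complement, written without an inverse. If \<open>y\<close>
  vanished, so would \<open>t\<close> and, because \<open>l \<noteq> 1\<close>, also \<open>x\<close>.\<close>

lemma saddle_point_eigenvector:
  assumes A: "pos_def_mat n A" and B: "B \<in> carrier_mat m n"
    and C: "C \<in> carrier_mat m m" and S: "S \<in> carrier_mat m m"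
    and v: "v \<in> carrier_vec (n + m)" "v \<noteq> 0\<^sub>v (n + m)"
    and eq: "four_block_mat A (transpose_mat B) B (- C) *\<^sub>v v = l \<cdot>\<^sub>v (block_diag2 A S *\<^sub>v v)"
    and l: "l \<noteq> 1"
  obtains y t where "y \<in> carrier_vec m" "y \<noteq> 0\<^sub>v m" "t \<in> carrier_vec n"
    "A *\<^sub>v t = transpose_mat B *\<^sub>v y"
    "t \<bullet> (A *\<^sub>v t) = (l - 1) * (l * (y \<bullet> (S *\<^sub>v y)) + y \<bullet> (C *\<^sub>v y))"
proof -
  have Ac: "A \<in> carrier_mat n n"
    using A unfolding pos_def_mat_def by simp
  have Bt: "transpose_mat B \<in> carrier_mat n m" using B by simp
  obtain x y where xy: "x \<in> carrier_vec n" "y \<in> carrier_vec m" "v = x @\<^sub>v y"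
    using append_vec_cases[OF v(1)] .
  define Ax Bx By Cy Sy where "Ax = A *\<^sub>v x" and "Bx = B *\<^sub>v x" and "By = transpose_mat B *\<^sub>v y"
    and "Cy = C *\<^sub>v y" and "Sy = S *\<^sub>v y"
  note d = Ax_def Bx_def By_def Cy_def Sy_def
  have c: "Ax \<in> carrier_vec n" "By \<in> carrier_vec n"
    "Bx \<in> carrier_vec m" "Cy \<in> carrier_vec m" "Sy \<in> carrier_vec m"
    unfolding d using Ac B C S xy Bt by auto
  have "(Ax + By) @\<^sub>v (Bx + (- C) *\<^sub>v y) = (l \<cdot>\<^sub>v Ax) @\<^sub>v (l \<cdot>\<^sub>v Sy)"
  proof -
    have "l \<cdot>\<^sub>v (Ax @\<^sub>v Sy) = (l \<cdot>\<^sub>v Ax) @\<^sub>v (l \<cdot>\<^sub>v Sy)"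
      by (rule eq_vecI) auto
    then show ?thesis
      using eq four_block_mat_mult_vec[OF Ac Bt B _ xy(1,2), of "- C"] C
      unfolding xy(3) block_diag2_mult_vec[OF Ac S xy(1,2)] d by simp
  qed
  moreover have "(- C) *\<^sub>v y = - Cy"
    unfolding d using C xy by simp
  ultimately have e: "Ax + By = l \<cdot>\<^sub>v Ax" "Bx - Cy = l \<cdot>\<^sub>v Sy"
    using c append_vec_eq[of "Ax + By" n "l \<cdot>\<^sub>v Ax"] by (auto simp: minus_add_uminus_vec[of _ m])
  have By: "By = (l - 1) \<cdot>\<^sub>v Ax"
  proof (rule eq_vecI)
    fix i assume "i < dim_vec ((l - 1) \<cdot>\<^sub>v Ax)"
    then have "i < n" using c by simp
    then show "By $ i = ((l - 1) \<cdot>\<^sub>v Ax) $ i"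
      using arg_cong[OF e(1), of "\<lambda>v. v $ i"] c by (simp add: algebra_simps)
  qed (use c in auto)
  define t where "t = (l - 1) \<cdot>\<^sub>v x"
  have t: "t \<in> carrier_vec n" unfolding t_def using xy by simp
  have At: "A *\<^sub>v t = By"
    unfolding By t_def d using Ac xy by (simp add: mult_mat_vec[of _ n n])
  have "y \<bullet> Bx - y \<bullet> Cy = l * (y \<bullet> Sy)"
    using arg_cong[OF e(2), of "\<lambda>v. y \<bullet> v"] c xy by (simp add: scalar_prod_minus_distrib[of _ m])
  moreover have "By \<bullet> x = y \<bullet> Bx"
    unfolding d using transpose_vec_mult_scalar[OF B xy(1,2)] .
  moreover have "t \<bullet> By = (l - 1) * (By \<bullet> x)"
    unfolding t_def using c xy by (simp add: comm_scalar_prod[of x n])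
  ultimately have "t \<bullet> (A *\<^sub>v t) = (l - 1) * (l * (y \<bullet> Sy) + y \<bullet> Cy)"
    unfolding At by (simp add: algebra_simps)
  moreover have "y \<noteq> 0\<^sub>v m"
  proof
    assume y: "y = 0\<^sub>v m"
    then have "By = 0\<^sub>v n"
      unfolding d using Bt by (auto intro!: eq_vecI)
    then have "t \<bullet> (A *\<^sub>v t) = 0"
      unfolding At using t by simp
    then have "t = 0\<^sub>v n"
      using A t unfolding pos_def_mat_def by fastforce
    have "x $ i = 0" if "i < n" for i
    proof -
      have "((l - 1) \<cdot>\<^sub>v x) $ i = 0"
        using \<open>t = 0\<^sub>v n\<close> that unfolding t_def by simp
      then show ?thesis using that l xy by simp
    qed
    then have "v = 0\<^sub>v (n + m)"
      unfolding xy(3) y using xy(1) by (intro eq_vecI) auto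
    with v show False by simp
  qed
  ultimately show thesis
    using that[OF xy(2) _ t] At unfolding d by simp
qed

lemma saddle_point_symmetric:
  fixes A B C :: "real mat"
  assumes "A \<in> carrier_mat n n" "B \<in> carrier_mat m n" "C \<in> carrier_mat m m"
    and "transpose_mat A = A" "transpose_mat C = C"
  shows "four_block_mat A (transpose_mat B) B (- C) \<in> carrier_mat (n + m) (n + m)"
    and "transpose_mat (four_block_mat A (transpose_mat B) B (- C))
      = four_block_mat A (transpose_mat B) B (- C)"
proof -
  show "four_block_mat A (transpose_mat B) B (- C) \<in> carrier_mat (n + m) (n + m)"
    using assms by (intro four_block_carrier_mat) auto
  show "transpose_mat (four_block_mat A (transpose_mat B) B (- C))
      = four_block_mat A (transpose_mat B) B (- C)"
    using assms by (subst transpose_four_block_mat[of _ n n _ m _ m]) (auto simp: transpose_uminus)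
qed

theorem preconditioned_saddle_point_eigenvalue:
  assumes A: "pos_def_mat n A" and B: "B \<in> carrier_mat m n"
    and C: "C \<in> carrier_mat m m" "transpose_mat C = C" and S: "pos_def_mat m S"
    and ev: "z \<in> spectrum (map_mat complex_of_real
      (minv (block_diag2 A S) * four_block_mat A (transpose_mat B) B (- C)))"
    and z1: "z \<noteq> 1"
  obtains l y t where "z = complex_of_real l" "l \<noteq> 1" "y \<in> carrier_vec m" "y \<bullet> (S *\<^sub>v y) > 0"
    "t \<in> carrier_vec n" "A *\<^sub>v t = transpose_mat B *\<^sub>v y"
    "t \<bullet> (A *\<^sub>v t) = (l - 1) * (l * (y \<bullet> (S *\<^sub>v y)) + y \<bullet> (C *\<^sub>v y))"
proof -
  have c: "A \<in> carrier_mat n n" "S \<in> carrier_mat m m" and t: "transpose_mat A = A"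
    using A S unfolding pos_def_mat_def by auto
  obtain l v where l: "z = complex_of_real l" and v: "v \<in> carrier_vec (n + m)" "v \<noteq> 0\<^sub>v (n + m)"
    "four_block_mat A (transpose_mat B) B (- C) *\<^sub>v v = l \<cdot>\<^sub>v (block_diag2 A S *\<^sub>v v)"
    using generalized_symmetric_eigenvalue_real[OF pos_def_mat_block_diag2[OF A S]
        saddle_point_symmetric[OF c(1) B C(1) t C(2)] ev] .
  have l1: "l \<noteq> 1" using l z1 by auto
  obtain y t where yt: "y \<in> carrier_vec m" "y \<noteq> 0\<^sub>v m" "t \<in> carrier_vec n"
    "A *\<^sub>v t = transpose_mat B *\<^sub>v y"
    "t \<bullet> (A *\<^sub>v t) = (l - 1) * (l * (y \<bullet> (S *\<^sub>v y)) + y \<bullet> (C *\<^sub>v y))"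
    using saddle_point_eigenvector[OF A B C(1) c(2) v l1] .
  moreover have "y \<bullet> (S *\<^sub>v y) > 0"
    using S yt unfolding pos_def_mat_def by simp
  ultimately show thesis
    using that l l1 by blast
qed


section \<open>Bounds for the roots of the scalar equations\<close>

text \<open>Here \<open>(2 l - 1)\<^sup>2 = 1 + 4 l (l - 1)\<close> lies between \<open>3\<close> and \<open>1 + 4 \<xi>\<close>. The positive branch
  starts at \<open>(1 + sqrt 3) / 2 > 1\<close>; with the lower end \<open>1\<close> the interval has room for the eigenvalue
  \<open>1\<close> as well.\<close>

lemma aug_eigenvalue_range:
  fixes l \<xi> :: real
  assumes "1 / 2 \<le> l * (l - 1)" and "l * (l - 1) \<le> \<xi>"
  shows "l \<in> {(1 - sqrt (1 + 4 * \<xi>)) / 2 .. (1 - sqrt 3) / 2} \<union> {1 .. (1 + sqrt (1 + 4 * \<xi>)) / 2}"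
proof -
  have sq: "(2 * l - 1)\<^sup>2 = 1 + 4 * (l * (l - 1))"
    by (simp add: power2_eq_square algebra_simps)
  have u: "2 * l - 1 \<le> sqrt (1 + 4 * \<xi>)" "- (2 * l - 1) \<le> sqrt (1 + 4 * \<xi>)"
    using assms(2) sq power2_minus[of "2 * l - 1"] by (intro real_le_rsqrt; linarith)+
  have "sqrt 3 \<le> sqrt ((2 * l - 1)\<^sup>2)"
    using assms(1) sq by (intro real_sqrt_le_mono) linarith
  then have "sqrt 3 \<le> \<bar>2 * l - 1\<bar>" by simp
  moreover have "1 \<le> sqrt (3::real)" by simp
  ultimately consider "2 * l - 1 \<ge> sqrt 3" "2 * l - 1 \<ge> 1" | "2 * l - 1 \<le> - sqrt 3"
    by linarith
  then show ?thesis
    by cases (use u in auto)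
qed

text \<open>If \<open>l > 1\<close>, then \<open>l (l - 1) h \<le> f\<close>, which bounds \<open>l\<close> in terms of \<open>\<zeta>\<close>. If \<open>l < 1\<close>, the sign of \<open>f\<close> forces
  \<open>l h + g \<le> 0\<close>, hence \<open>l \<le> 0\<close>. Then \<open>l (l - 1) h = f + (1 - l) g \<ge> f + g \<ge> h / 2\<close> yields the upper
  end of the negative interval, and enlarging \<open>g\<close> to \<open>\<xi> h\<close> in \<open>f = (l - 1) (l h + g)\<close> yields the
  quadratic inequality \<open>(l - 1) (l + \<xi>) \<le> \<zeta>\<^sup>2\<close> whose smaller root is the lower end.\<close>

lemma red_eigenvalue_range:
  fixes l f g h \<zeta> \<xi> :: real
  assumes eq: "f = (l - 1) * (l * h + g)" and h: "h > 0" and f0: "f \<ge> 0" and g0: "g \<ge> 0"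
    and hfg: "h \<le> 2 * (f + g)" and fh: "f \<le> \<zeta>\<^sup>2 * h" and gh: "g \<le> \<xi> * h" and l: "l \<noteq> 1"
  shows "l \<in> {(- \<xi> + 1 - sqrt ((\<xi> + 1)\<^sup>2 + 4 * \<zeta>\<^sup>2)) / 2 .. (1 - sqrt 3) / 2}
    \<union> {1 .. (1 + sqrt (1 + 4 * \<zeta>\<^sup>2)) / 2}"
proof (cases "l > 1")
  case True
  have "l * (l - 1) * h \<le> \<zeta>\<^sup>2 * h"
  proof -
    have "(l - 1) * g \<ge> 0" using True g0 by simp
    then have "l * (l - 1) * h \<le> f" unfolding eq by (simp add: algebra_simps)
    with fh show ?thesis by linarith
  qed
  then have "l * (l - 1) \<le> \<zeta>\<^sup>2" using h by simp
  then have "(2 * l - 1)\<^sup>2 \<le> 1 + 4 * \<zeta>\<^sup>2"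
    by (simp add: power2_eq_square algebra_simps)
  then have "2 * l - 1 \<le> sqrt (1 + 4 * \<zeta>\<^sup>2)"
    by (rule real_le_rsqrt)
  with True show ?thesis by simp
next
  case False
  with l have l1: "l < 1" by simp
  have "l * h + g \<le> 0"
  proof (rule ccontr)
    assume "\<not> ?thesis"
    then have "(l - 1) * (l * h + g) < 0" using l1 by (simp add: mult_neg_pos)
    then show False using eq f0 by simp
  qed
  then have "l * h \<le> 0" using g0 by simp
  then have l0: "l \<le> 0" using h by (simp add: mult_le_0_iff)
  have "h / 2 \<le> f + g" using hfg by simp
  also have "\<dots> \<le> f + g * (1 - l)"
    using l0 g0 by (simp add: algebra_simps mult_nonneg_nonpos)
  also have "\<dots> = l * (l - 1) * h"
    unfolding eq by (simp add: algebra_simps)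
  finally have "1 / 2 * h \<le> l * (l - 1) * h" by simp
  then have "1 / 2 \<le> l * (l - 1)" using h by (simp only: mult_le_cancel_right_pos)
  then have "3 \<le> (1 - 2 * l)\<^sup>2"
    by (simp add: power2_eq_square algebra_simps)
  then have up: "sqrt 3 \<le> 1 - 2 * l"
    using l0 by (intro real_le_lsqrt) auto
  have "(l - 1) * (l + \<xi>) * h = (l - 1) * (l * h + \<xi> * h)"
    by (simp add: algebra_simps)
  also have "\<dots> \<le> (l - 1) * (l * h + g)"
    using gh l1 by (intro mult_left_mono_neg) auto
  also have "\<dots> \<le> \<zeta>\<^sup>2 * h" using fh eq by simp
  finally have "(l - 1) * (l + \<xi>) \<le> \<zeta>\<^sup>2" using h by simp
  then have "(1 - \<xi> - 2 * l)\<^sup>2 \<le> (\<xi> + 1)\<^sup>2 + 4 * \<zeta>\<^sup>2"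
    by (simp add: power2_eq_square algebra_simps)
  then have "1 - \<xi> - 2 * l \<le> sqrt ((\<xi> + 1)\<^sup>2 + 4 * \<zeta>\<^sup>2)"
    by (rule real_le_rsqrt)
  with up show ?thesis by simp
qed

section \<open>The spectral norm and its invariance under transposition\<close>

lemma euclid_norm_eq_L2_set: "euclid_norm v = L2_set (($) v) {0..<dim_vec v}"
  unfolding euclid_norm_def L2_set_def scalar_prod_def by (simp add: power2_eq_square)

lemma euclid_norm_nonneg: "euclid_norm v \<ge> 0"
  unfolding euclid_norm_eq_L2_set by simp

lemma euclid_norm_square: "(euclid_norm v)\<^sup>2 = v \<bullet> v"
proof -
  have "v \<bullet> v \<ge> 0"
    unfolding scalar_prod_def by (intro sum_nonneg) simp
  then show ?thesis unfolding euclid_norm_def by simp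
qed

lemma scalar_prod_le_euclid_norms:
  assumes "v \<in> carrier_vec n" and "w \<in> carrier_vec n"
  shows "\<bar>v \<bullet> w\<bar> \<le> euclid_norm v * euclid_norm w"
proof -
  have "\<bar>v \<bullet> w\<bar> \<le> (\<Sum>i = 0..<n. \<bar>v $ i\<bar> * \<bar>w $ i\<bar>)"
    using assms sum_abs[of "\<lambda>i. v $ i * w $ i" "{0..<n}"] unfolding scalar_prod_def
    by (simp add: abs_mult)
  also have "\<dots> \<le> euclid_norm v * euclid_norm w"
    using assms L2_set_mult_ineq[of "($) v" "($) w" "{0..<n}"] unfolding euclid_norm_eq_L2_set by simp
  finally show ?thesis .
qed

text \<open>By the Cauchy-Schwarz inequality for each row, the sum of the row norms is an upper bound. Without
  boundedness the supremum in the definition of the spectral norm would carry no information.\<close>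

lemma spectral_norm_set_bdd_above:
  "bdd_above {euclid_norm (A *\<^sub>v v) | v. v \<in> carrier_vec (dim_col A) \<and> euclid_norm v \<le> 1}"
proof (rule bdd_aboveI)
  fix x assume "x \<in> {euclid_norm (A *\<^sub>v v) | v. v \<in> carrier_vec (dim_col A) \<and> euclid_norm v \<le> 1}"
  then obtain v where x: "x = euclid_norm (A *\<^sub>v v)" and v: "v \<in> carrier_vec (dim_col A)" "euclid_norm v \<le> 1"
    by auto
  have "x \<le> (\<Sum>i = 0..<dim_row A. \<bar>(A *\<^sub>v v) $ i\<bar>)"
    unfolding x euclid_norm_eq_L2_set dim_mult_mat_vec by (rule L2_set_le_sum_abs)
  also have "\<dots> \<le> (\<Sum>i = 0..<dim_row A. euclid_norm (row A i))"
  proof (rule sum_mono)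
    fix i assume "i \<in> {0..<dim_row A}"
    then have "\<bar>(A *\<^sub>v v) $ i\<bar> \<le> euclid_norm (row A i) * euclid_norm v"
      using scalar_prod_le_euclid_norms[OF row_carrier v(1)] by simp
    also have "\<dots> \<le> euclid_norm (row A i) * 1"
      using v(2) euclid_norm_nonneg by (intro mult_left_mono) auto
    finally show "\<bar>(A *\<^sub>v v) $ i\<bar> \<le> euclid_norm (row A i)" by simp
  qed
  finally show "x \<le> (\<Sum>i = 0..<dim_row A. euclid_norm (row A i))" .
qed

lemma euclid_norm_mult_le_spectral_norm:
  assumes A: "A \<in> carrier_mat m n" and v: "v \<in> carrier_vec n"
  shows "euclid_norm (A *\<^sub>v v) \<le> spectral_norm A * euclid_norm v"
proof -
  have scale: "euclid_norm (c \<cdot>\<^sub>v w) = c * euclid_norm w" if "c \<ge> 0" for c w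
    using that unfolding euclid_norm_eq_L2_set
    by (simp add: L2_set_right_distrib cong: L2_set_cong_simp)
  show ?thesis
  proof (cases "euclid_norm v = 0")
    case True
    then have "v $ i = 0" if "i < n" for i
      using that v unfolding euclid_norm_eq_L2_set by (simp add: L2_set_eq_0_iff)
    then have "v = 0 \<cdot>\<^sub>v v"
      using v by (intro eq_vecI) auto
    then have "A *\<^sub>v v = 0 \<cdot>\<^sub>v (A *\<^sub>v v)"
      using mult_mat_vec[OF A v] by metis
    then show ?thesis
      using True scale[of 0 "A *\<^sub>v v"] by simp
  next
    case False
    define r where "r = euclid_norm v"
    have r: "r > 0" using False euclid_norm_nonneg[of v] unfolding r_def by simp
    define w where "w = (1 / r) \<cdot>\<^sub>v v"
    have w: "w \<in> carrier_vec (dim_col A)" "euclid_norm w \<le> 1"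
      using A v r scale[of "1 / r" v] unfolding w_def r_def[symmetric] by auto
    have "euclid_norm (A *\<^sub>v w) = 1 / r * euclid_norm (A *\<^sub>v v)"
      unfolding w_def using mult_mat_vec[OF A v] r scale by simp
    moreover have "euclid_norm (A *\<^sub>v w) \<le> spectral_norm A"
      unfolding spectral_norm_def using w by (intro cSup_upper spectral_norm_set_bdd_above) auto
    ultimately have "1 / r * euclid_norm (A *\<^sub>v v) \<le> spectral_norm A"
      by simp
    then show ?thesis
      using r unfolding r_def[symmetric] by (simp add: field_simps)
  qed
qed

lemma spectral_norm_nonneg: "spectral_norm A \<ge> 0"
proof -
  have "0 \<le> euclid_norm (A *\<^sub>v 0\<^sub>v (dim_col A))"
    by (rule euclid_norm_nonneg)
  also have "\<dots> \<le> spectral_norm A"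
    unfolding spectral_norm_def
    by (intro cSup_upper spectral_norm_set_bdd_above)
      (auto intro!: exI[of _ "0\<^sub>v (dim_col A)"] simp: euclid_norm_def)
  finally show ?thesis .
qed

text \<open>For \<open>w = A\<^sup>T v\<close> one has \<open>\<parallel>w\<parallel>\<^sup>2 = v \<bullet> A w \<le> \<parallel>v\<parallel> \<parallel>A\<parallel> \<parallel>w\<parallel>\<close>; cancel \<open>\<parallel>w\<parallel>\<close>.\<close>

lemma euclid_norm_transpose_mult_le_spectral_norm:
  assumes A: "A \<in> carrier_mat m n" and v: "v \<in> carrier_vec m"
  shows "euclid_norm (transpose_mat A *\<^sub>v v) \<le> spectral_norm A * euclid_norm v"
proof -
  define w where "w = transpose_mat A *\<^sub>v v"
  have w: "w \<in> carrier_vec n" unfolding w_def using A v by auto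
  have "euclid_norm w * euclid_norm w = w \<bullet> w"
    using euclid_norm_square[of w] by (simp add: power2_eq_square)
  also have "\<dots> = v \<bullet> (A *\<^sub>v w)"
    using transpose_vec_mult_scalar[OF A w v] unfolding w_def .
  also have "\<dots> \<le> euclid_norm v * euclid_norm (A *\<^sub>v w)"
    using scalar_prod_le_euclid_norms[of v m "A *\<^sub>v w"] A v w by auto
  also have "\<dots> \<le> euclid_norm v * (spectral_norm A * euclid_norm w)"
    by (intro mult_left_mono euclid_norm_mult_le_spectral_norm[OF A w] euclid_norm_nonneg)
  finally have "euclid_norm w * euclid_norm w \<le> (spectral_norm A * euclid_norm v) * euclid_norm w"
    by (simp add: ac_simps)
  then show ?thesis
    using euclid_norm_nonneg[of w] euclid_norm_nonneg[of v] spectral_norm_nonneg[of A]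
    unfolding w_def[symmetric] by (cases "euclid_norm w = 0") (auto simp: mult_le_cancel_right)
qed


section \<open>Selection matrices\<close>

lemma P_mat_carrier:
  assumes "C \<subseteq> {0..<n}"
  shows "P_mat n C \<in> carrier_mat (card C) n"
proof -
  have "{i. i < n \<and> i \<in> C} = C" using assms by auto
  then have "card {i. i < n \<and> i \<in> C} = card C" by simp
  then show ?thesis
    unfolding P_mat_def Pi_mat_def by (intro carrier_matI) (simp_all add: dim_submatrix mat_diag_def)
qed

lemma P_mat_index:
  assumes C: "C \<subseteq> {0..<n}" and "r < card C" and j: "j < n"
  shows "P_mat n C $$ (r, j) = (if pick C r = j then 1 else 0)"
proof -
  have "{i. i < n \<and> i \<in> C} = C" using C by auto
  then have "r < card {i. i < dim_row (Pi_mat n C) \<and> i \<in> C}"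
    and "j < card {j. j < dim_col (Pi_mat n C) \<and> j \<in> UNIV}"
    using assms by (simp_all add: Pi_mat_def mat_diag_def)
  then have "P_mat n C $$ (r, j) = Pi_mat n C $$ (pick C r, j)"
    unfolding P_mat_def by (simp add: submatrix_index pick_UNIV)
  moreover have "pick C r \<in> C" using assms by (intro pick_in_set_le)
  ultimately show ?thesis
    using C j by (auto simp: Pi_mat_def mat_diag_def)
qed

lemma P_mat_mult_transpose:
  assumes C: "C \<subseteq> {0..<n}"
  shows "P_mat n C * transpose_mat (P_mat n C) = 1\<^sub>m (card C)"
proof (rule eq_matI)
  note P = P_mat_carrier[OF C]
  fix r s assume "r < dim_row (1\<^sub>m (card C) :: real mat)" "s < dim_col (1\<^sub>m (card C) :: real mat)"
  then have rs: "r < card C" "s < card C" by auto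
  have p: "pick C r < n"
    using pick_in_set_le[OF rs(1)] C by auto
  have "(P_mat n C * transpose_mat (P_mat n C)) $$ (r, s)
      = (\<Sum>j = 0..<n. P_mat n C $$ (r, j) * P_mat n C $$ (s, j))"
    using P rs by (auto simp: scalar_prod_def)
  also have "\<dots> = (\<Sum>j = 0..<n. if j = pick C r then if pick C s = j then 1 else 0 else 0)"
    using rs C by (intro sum.cong) (auto simp: P_mat_index)
  also have "\<dots> = (if pick C s = pick C r then 1 else 0)"
    using p by (simp add: sum.delta)
  also have "\<dots> = (if r = s then 1 else 0)"
    using card_pick_le[OF rs(1)] card_pick_le[OF rs(2)] by metis
  finally show "(P_mat n C * transpose_mat (P_mat n C)) $$ (r, s) = 1\<^sub>m (card C) $$ (r, s)"
    using rs by simp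
qed (use P_mat_carrier[OF C] in auto)

lemma transpose_P_mat_mult:
  assumes C: "C \<subseteq> {0..<n}"
  shows "transpose_mat (P_mat n C) * P_mat n C = Pi_mat n C"
proof (rule eq_matI)
  note P = P_mat_carrier[OF C]
  have fin: "finite C" using C finite_subset by blast
  fix i j assume "i < dim_row (Pi_mat n C)" "j < dim_col (Pi_mat n C)"
  then have ij: "i < n" "j < n" by (auto simp: Pi_mat_def mat_diag_def)
  define s where "s = card {a \<in> C. a < i}"
  have pick_iff: "pick C r = i \<longleftrightarrow> i \<in> C \<and> r = s" if "r < card C" for r
    unfolding s_def using pick_card_in_set[of i C] card_pick_le[OF that] pick_in_set_le[OF that] by auto
  have s: "s < card C" if "i \<in> C"
    unfolding s_def using that fin by (intro psubset_card_mono) auto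
  have "(transpose_mat (P_mat n C) * P_mat n C) $$ (i, j)
      = (\<Sum>r = 0..<card C. P_mat n C $$ (r, i) * P_mat n C $$ (r, j))"
    using P ij by (auto simp: scalar_prod_def)
  also have "\<dots> = (\<Sum>r = 0..<card C. if r = s then if i \<in> C \<and> i = j then 1 else 0 else 0)"
    using ij C pick_iff by (intro sum.cong) (auto simp: P_mat_index)
  also have "\<dots> = (if i \<in> C \<and> i = j then 1 else 0)"
    using s by (auto simp: sum.delta)
  also have "\<dots> = Pi_mat n C $$ (i, j)"
    using ij by (simp add: Pi_mat_def mat_diag_def)
  finally show "(transpose_mat (P_mat n C) * P_mat n C) $$ (i, j) = Pi_mat n C $$ (i, j)" .
qed (use P_mat_carrier[OF C] in \<open>auto simp: Pi_mat_def mat_diag_def\<close>)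


section \<open>Quadratic forms weighted by a diagonal matrix\<close>

text \<open>The triangle inequality \<open>\<parallel>c - a\<parallel> \<le> \<parallel>c\<parallel> + \<parallel>a\<parallel> \<le> (1 + k) \<parallel>c\<parallel>\<close> for a weighted Euclidean norm.\<close>

lemma weighted_square_sum_diff_le:
  fixes w a c :: "'i \<Rightarrow> real"
  assumes w: "\<And>i. i \<in> I \<Longrightarrow> w i \<ge> 0" and k: "k \<ge> 0"
    and le: "(\<Sum>i\<in>I. w i * (a i)\<^sup>2) \<le> k\<^sup>2 * (\<Sum>i\<in>I. w i * (c i)\<^sup>2)"
  shows "(\<Sum>i\<in>I. w i * (c i - a i)\<^sup>2) \<le> (1 + k)\<^sup>2 * (\<Sum>i\<in>I. w i * (c i)\<^sup>2)"
proof -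
  define N where "N x = L2_set (\<lambda>i. sqrt (w i) * x i) I" for x
  have N2: "(N x)\<^sup>2 = (\<Sum>i\<in>I. w i * (x i)\<^sup>2)" for x
  proof -
    have "(\<Sum>i\<in>I. (sqrt (w i) * x i)\<^sup>2) = (\<Sum>i\<in>I. w i * (x i)\<^sup>2)"
      using w by (intro sum.cong) (auto simp: power_mult_distrib)
    moreover have "(\<Sum>i\<in>I. (sqrt (w i) * x i)\<^sup>2) \<ge> 0"
      by (intro sum_nonneg) simp
    ultimately show ?thesis
      unfolding N_def L2_set_def by simp
  qed
  have N0: "N x \<ge> 0" for x unfolding N_def by simp
  have "(N a)\<^sup>2 \<le> (k * N c)\<^sup>2"
    using le unfolding N2 power_mult_distrib by simp
  then have "N a \<le> k * N c"
    using k N0 by (simp add: power2_le_iff_abs_le)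
  moreover have "N (\<lambda>i. c i - a i) \<le> N c + N a"
  proof -
    have "N (\<lambda>i. c i - a i) = L2_set (\<lambda>i. sqrt (w i) * c i + - (sqrt (w i) * a i)) I"
      unfolding N_def by (rule L2_set_cong) (auto simp: algebra_simps)
    also have "\<dots> \<le> N c + L2_set (\<lambda>i. - (sqrt (w i) * a i)) I"
      unfolding N_def by (rule L2_set_triangle_ineq)
    also have "L2_set (\<lambda>i. - (sqrt (w i) * a i)) I = N a"
      unfolding N_def L2_set_def by simp
    finally show ?thesis .
  qed
  ultimately have "N (\<lambda>i. c i - a i) \<le> (1 + k) * N c"
    by (simp add: algebra_simps)
  then have "(N (\<lambda>i. c i - a i))\<^sup>2 \<le> ((1 + k) * N c)\<^sup>2"
    using N0 by (intro power_mono) auto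
  then show ?thesis unfolding N2 power_mult_distrib .
qed

text \<open>The transpose of \<open>F = D W\<^sup>-\<^sup>1 K D\<^sup>-\<^sup>1\<close>, \<open>D\<close> the square root of the diagonal matrix, maps
  \<open>D\<^sup>-\<^sup>1 W\<^sup>T y\<close> to \<open>D\<^sup>-\<^sup>1 K\<^sup>T y\<close>: the factors \<open>D\<close> and \<open>W\<^sup>T\<close> cancel. The squared Euclidean norms of
  these two vectors are the weighted sums.\<close>

lemma scaled_spectral_norm_bound:
  assumes d: "\<And>i. i < n \<Longrightarrow> d i > 0" and W: "W \<in> carrier_mat n n" "det W \<noteq> 0"
    and K: "K \<in> carrier_mat n n" and y: "y \<in> carrier_vec n"
    and z: "\<zeta> = spectral_norm (diag_sqrt (mat_diag n d) * minv W * K * minv (diag_sqrt (mat_diag n d)))"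
  shows "(\<Sum>i = 0..<n. 1 / d i * ((transpose_mat K *\<^sub>v y) $ i)\<^sup>2)
    \<le> \<zeta>\<^sup>2 * (\<Sum>i = 0..<n. 1 / d i * ((transpose_mat W *\<^sub>v y) $ i)\<^sup>2)"
proof -
  define D E where "D = mat_diag n (\<lambda>i. sqrt (d i))" and "E = mat_diag n (\<lambda>i. 1 / sqrt (d i))"
  have DE: "D \<in> carrier_mat n n" "E \<in> carrier_mat n n"
    "transpose_mat D = D" "transpose_mat E = E" unfolding D_def E_def by auto
  have Dd: "diag_sqrt (mat_diag n d) = D"
    unfolding D_def diag_sqrt_def by (auto intro!: eq_matI simp: mat_diag_def)
  have mD: "minv D = E"
    unfolding D_def E_def using d by (intro minv_mat_diag) (simp add: less_imp_neq[symmetric])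
  note inv = minv_inverse[OF W]
  define F where "F = D * minv W * K * E"
  have F: "F \<in> carrier_mat n n" and zF: "\<zeta> = spectral_norm F"
    unfolding F_def z Dd mD using DE K inv by auto
  define u c where "u = transpose_mat K *\<^sub>v y" and "c = transpose_mat W *\<^sub>v y"
  have uc: "u \<in> carrier_vec n" "c \<in> carrier_vec n"
    unfolding u_def c_def using K W y by auto
  have "transpose_mat F = E * (transpose_mat K * (transpose_mat (minv W) * D))"
    unfolding F_def using DE K inv
    by (simp add: transpose_mult[of _ n n _ n])
  then have "transpose_mat F *\<^sub>v (E *\<^sub>v c) = E *\<^sub>v (transpose_mat K *\<^sub>v (transpose_mat (minv W) *\<^sub>v (D *\<^sub>v (E *\<^sub>v c))))"
    using DE K inv uc
    by (simp add: assoc_mult_mat_vec[of _ n n _ n])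
  also have "D *\<^sub>v (E *\<^sub>v c) = c"
    using uc d unfolding D_def E_def
    by (intro eq_vecI) (auto simp: mat_diag_mult_vec[of _ n] less_imp_neq[symmetric])
  also have "transpose_mat (minv W) *\<^sub>v c = y"
  proof -
    have "transpose_mat (minv W) *\<^sub>v c = transpose_mat (minv W) * transpose_mat W *\<^sub>v y"
      unfolding c_def using inv(1) W(1) y by (intro assoc_mult_mat_vec[symmetric]) auto
    also have "transpose_mat (minv W) * transpose_mat W = 1\<^sub>m n"
      using transpose_mult[OF W(1) inv(1)] unfolding inv(2) by simp
    finally show ?thesis using y by simp
  qed
  finally have tF: "transpose_mat F *\<^sub>v (E *\<^sub>v c) = E *\<^sub>v u"
    unfolding u_def .
  have E2: "(euclid_norm (E *\<^sub>v x))\<^sup>2 = (\<Sum>i = 0..<n. 1 / d i * (x $ i)\<^sup>2)" if "x \<in> carrier_vec n" for x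
    unfolding euclid_norm_square E_def mat_diag_mult_vec[OF that] using d
    by (auto simp: scalar_prod_def less_imp_le power2_eq_square intro!: sum.cong)
  have "E *\<^sub>v c \<in> carrier_vec n" using DE uc by auto
  from euclid_norm_transpose_mult_le_spectral_norm[OF F this]
  have "euclid_norm (E *\<^sub>v u) \<le> \<zeta> * euclid_norm (E *\<^sub>v c)"
    unfolding tF zF .
  then have "(euclid_norm (E *\<^sub>v u))\<^sup>2 \<le> (\<zeta> * euclid_norm (E *\<^sub>v c))\<^sup>2"
    using euclid_norm_nonneg by (intro power_mono)
  then show ?thesis
    unfolding power_mult_distrib E2[OF uc(1)] E2[OF uc(2)] unfolding u_def c_def .
qed

section \<open>Quadratic forms of the optimality system\<close>

text \<open>The mass matrix enters through its diagonal \<open>d\<close> only, so that all quadratic forms become sums over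
  coordinates.\<close>

locale optimality_system =
  fixes n :: nat and L Mb :: "real mat" and d :: "nat \<Rightarrow> real" and \<I> \<A> :: "nat set" and \<alpha> :: real
  assumes L: "L \<in> carrier_mat n n" and Mb: "Mb \<in> carrier_mat n n"
    and d_pos: "\<And>i. i < n \<Longrightarrow> d i > 0"
    and active: "\<A> = {0..<n} - \<I>"
    and \<alpha>_pos: "\<alpha> > 0"
    and W_det: "det (sqrt \<alpha> \<cdot>\<^sub>m L + Mb * Pi_mat n \<I>) \<noteq> 0"
begin

definition M where "M = mat_diag n d"
definition W where "W = sqrt \<alpha> \<cdot>\<^sub>m L + Mb * Pi_mat n \<I>"
definition P where "P = P_mat n \<A>"
definition k where "k = card \<A>"

text \<open>The quadratic form of \<open>M\<^sup>-\<^sup>1\<close>, on functions because coordinatewise sums and restrictions of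
  vectors are easier to write there.\<close>

definition wsum :: "(nat \<Rightarrow> real) \<Rightarrow> real" where
  "wsum a = (\<Sum>i = 0..<n. 1 / d i * (a i)\<^sup>2)"

text \<open>The coordinates of \<open>L\<^sup>T y\<close>, of \<open>Mb\<^sup>T y\<close> and of the restriction of the latter to the inactive set \<open>\<I>\<close>.\<close>

definition Lt :: "real vec \<Rightarrow> nat \<Rightarrow> real" where "Lt y i = (transpose_mat L *\<^sub>v y) $ i"
definition Mt :: "real vec \<Rightarrow> nat \<Rightarrow> real" where "Mt y i = (transpose_mat Mb *\<^sub>v y) $ i"
definition Mt_in :: "real vec \<Rightarrow> nat \<Rightarrow> real" where "Mt_in y i = (if i \<in> \<I> then Mt y i else 0)"

lemma Pi_carrier [simp]: "Pi_mat n C \<in> carrier_mat n n"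
  unfolding Pi_mat_def by simp

lemma M_carrier: "M \<in> carrier_mat n n" and W_carrier: "W \<in> carrier_mat n n"
  and P_carrier: "P \<in> carrier_mat k n"
  unfolding M_def W_def P_def k_def using L Mb active by (auto intro!: P_mat_carrier)

lemma minv_M: "minv M = mat_diag n (\<lambda>i. 1 / d i)"
  unfolding M_def using d_pos by (intro minv_mat_diag) (simp add: less_imp_neq[symmetric])

lemma M_pos_def: "pos_def_mat n M" and minv_M_pos_def: "pos_def_mat n (minv M)"
  unfolding minv_M unfolding M_def using d_pos by (auto intro!: pos_def_mat_diag)

lemma wsum_eq_quadratic_form:
  "v \<in> carrier_vec n \<Longrightarrow> v \<bullet> (minv M *\<^sub>v v) = wsum (($) v)"
  unfolding minv_M wsum_def by (simp add: mat_diag_quadratic_form)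

lemma wsum_cong: "(\<And>i. i < n \<Longrightarrow> a i = b i) \<Longrightarrow> wsum a = wsum b"
  unfolding wsum_def by simp

lemma transpose_W_index:
  assumes y: "y \<in> carrier_vec n" and i: "i < n"
  shows "(transpose_mat W *\<^sub>v y) $ i = sqrt \<alpha> * Lt y i + Mt_in y i"
proof -
  have "transpose_mat W = sqrt \<alpha> \<cdot>\<^sub>m transpose_mat L + Pi_mat n \<I> * transpose_mat Mb"
  proof -
    have "transpose_mat (Mb * Pi_mat n \<I>) = Pi_mat n \<I> * transpose_mat Mb"
      using transpose_mult[OF Mb Pi_carrier] by (simp add: Pi_mat_def)
    then show ?thesis
      unfolding W_def using L Mb transpose_add[of "sqrt \<alpha> \<cdot>\<^sub>m L" n n "Mb * Pi_mat n \<I>"]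
      by (simp add: transpose_smult_mat)
  qed
  moreover have "(sqrt \<alpha> \<cdot>\<^sub>m transpose_mat L + Pi_mat n \<I> * transpose_mat Mb) *\<^sub>v y
      = (sqrt \<alpha> \<cdot>\<^sub>m transpose_mat L) *\<^sub>v y + (Pi_mat n \<I> * transpose_mat Mb) *\<^sub>v y"
    using L Mb y by (intro add_mult_distrib_mat_vec[of _ n n] mult_carrier_mat[of _ n n]) auto
  moreover have "(sqrt \<alpha> \<cdot>\<^sub>m transpose_mat L) *\<^sub>v y = sqrt \<alpha> \<cdot>\<^sub>v (transpose_mat L *\<^sub>v y)"
    using L y by (intro smult_mat_mult_vec) auto
  moreover have "(Pi_mat n \<I> * transpose_mat Mb) *\<^sub>v y = Pi_mat n \<I> *\<^sub>v (transpose_mat Mb *\<^sub>v y)"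
    using Mb y by (intro assoc_mult_mat_vec[of _ n n _ n]) auto
  moreover have "transpose_mat Mb *\<^sub>v y \<in> carrier_vec n" using Mb y by auto
  ultimately show ?thesis
    using i L unfolding Lt_def Mt_in_def Mt_def Pi_mat_def
    by (simp add: mat_diag_mult_vec)
qed

lemma SS_hat_eq: "SS_hat n \<alpha> L Mb M \<I> = W * minv M * transpose_mat W"
  unfolding SS_hat_def W_def ..

lemma SS_hat_pos_def: "pos_def_mat n (SS_hat n \<alpha> L Mb M \<I>)"
  unfolding SS_hat_eq
proof (rule pos_def_mat_congruence[OF minv_M_pos_def W_carrier])
  fix v assume "v \<in> carrier_vec n" "transpose_mat W *\<^sub>v v = 0\<^sub>v n"
  moreover have "det (transpose_mat W) \<noteq> 0"
    using W_det det_transpose[OF W_carrier] unfolding W_def by simp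
  ultimately show "v = 0\<^sub>v n"
    using det_0_iff_vec_prod_zero[of "transpose_mat W" n] W_carrier by auto
qed

lemma SS_hat_quadratic_form:
  assumes y: "y \<in> carrier_vec n"
  shows "y \<bullet> (SS_hat n \<alpha> L Mb M \<I> *\<^sub>v y) = wsum (\<lambda>i. sqrt \<alpha> * Lt y i + Mt_in y i)"
proof -
  have "transpose_mat W *\<^sub>v y \<in> carrier_vec n" using W_carrier y by auto
  moreover have "minv M \<in> carrier_mat n n" unfolding minv_M by simp
  ultimately have "y \<bullet> (SS_hat n \<alpha> L Mb M \<I> *\<^sub>v y) = wsum (($) (transpose_mat W *\<^sub>v y))"
    unfolding SS_hat_eq using congruence_quadratic_form[OF _ W_carrier y, of "minv M"]
      wsum_eq_quadratic_form by simp
  then show ?thesis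
    using transpose_W_index[OF y] by (simp cong: wsum_cong)
qed

lemma wsum_nonneg: "wsum a \<ge> 0"
  unfolding wsum_def using d_pos by (intro sum_nonneg) (simp add: less_imp_le)

lemma wsum_add_le: "wsum (\<lambda>i. a i + b i) \<le> 2 * (wsum a + wsum b)"
proof -
  have "1 / d i * (a i + b i)\<^sup>2 \<le> 2 * (1 / d i * (a i)\<^sup>2 + 1 / d i * (b i)\<^sup>2)" if "i < n" for i
  proof -
    have "(a i + b i)\<^sup>2 \<le> 2 * ((a i)\<^sup>2 + (b i)\<^sup>2)"
      using sum_squares_bound[of "a i" "b i"] by (simp add: power2_sum)
    from mult_left_mono[OF this, of "1 / d i"] show ?thesis
      using d_pos[OF that] by (simp add: algebra_simps)
  qed
  then have "wsum (\<lambda>i. a i + b i) \<le> (\<Sum>i = 0..<n. 2 * (1 / d i * (a i)\<^sup>2 + 1 / d i * (b i)\<^sup>2))"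
    unfolding wsum_def by (intro sum_mono) simp
  then show ?thesis
    unfolding wsum_def by (simp add: sum.distrib sum_distrib_left)
qed

definition \<zeta> where
  "\<zeta> = spectral_norm (diag_sqrt M * minv W * (sqrt \<alpha> \<cdot>\<^sub>m L) * minv (diag_sqrt M))"

lemma wsum_Lt_le:
  assumes y: "y \<in> carrier_vec n"
  shows "wsum (\<lambda>i. sqrt \<alpha> * Lt y i) \<le> \<zeta>\<^sup>2 * wsum (\<lambda>i. sqrt \<alpha> * Lt y i + Mt_in y i)"
proof -
  have "(transpose_mat (sqrt \<alpha> \<cdot>\<^sub>m L) *\<^sub>v y) $ i = sqrt \<alpha> * Lt y i" if "i < n" for i
    using that L y smult_mat_mult_vec[of "transpose_mat L" n n y "sqrt \<alpha>"]
    unfolding Lt_def transpose_smult_mat by simp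
  moreover have "wsum (($) (transpose_mat (sqrt \<alpha> \<cdot>\<^sub>m L) *\<^sub>v y)) \<le> \<zeta>\<^sup>2 * wsum (($) (transpose_mat W *\<^sub>v y))"
    unfolding wsum_def
    using scaled_spectral_norm_bound[OF d_pos W_carrier _ _ y, where K = "sqrt \<alpha> \<cdot>\<^sub>m L" and \<zeta> = \<zeta>] L W_det
    unfolding \<zeta>_def M_def W_def by simp
  ultimately show ?thesis
    using transpose_W_index[OF y] by (simp cong: wsum_cong)
qed

text \<open>The vector \<open>\<Pi>\<^sub>I Mb\<^sup>T y\<close> is the difference of \<open>W\<^sup>T y\<close> and \<open>sqrt \<alpha> L\<^sup>T y\<close>.\<close>

lemma wsum_Mt_in_le:
  assumes y: "y \<in> carrier_vec n"
  shows "wsum (Mt_in y) \<le> (1 + \<zeta>)\<^sup>2 * wsum (\<lambda>i. sqrt \<alpha> * Lt y i + Mt_in y i)"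
proof -
  have "\<zeta> \<ge> 0" unfolding \<zeta>_def by (rule spectral_norm_nonneg)
  then show ?thesis
    using weighted_square_sum_diff_le[of "{0..<n}" "\<lambda>i. 1 / d i" \<zeta> "\<lambda>i. sqrt \<alpha> * Lt y i"
        "\<lambda>i. sqrt \<alpha> * Lt y i + Mt_in y i"] wsum_Lt_le[OF y] d_pos
    unfolding wsum_def by (simp add: less_imp_le)
qed

text \<open>The negative of the lower right block of the reduced matrix.\<close>

definition C_red where "C_red = (1 / \<alpha>) \<cdot>\<^sub>m (Mb * minv M * Pi_mat n \<I> * transpose_mat Mb)"

lemma C_red_eq:
  "C_red = (1 / \<alpha>) \<cdot>\<^sub>m (Mb * mat_diag n (\<lambda>i. if i \<in> \<I> then 1 / d i else 0) * transpose_mat Mb)"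
proof -
  have "mat_diag n (\<lambda>i. 1 / d i) * Pi_mat n \<I> = mat_diag n (\<lambda>i. if i \<in> \<I> then 1 / d i else 0)"
    unfolding Pi_mat_def mat_diag_diag by (rule arg_cong[of _ _ "mat_diag n"]) auto
  then have "Mb * minv M * Pi_mat n \<I> = Mb * mat_diag n (\<lambda>i. if i \<in> \<I> then 1 / d i else 0)"
    unfolding minv_M using assoc_mult_mat[OF Mb mat_diag_dim Pi_carrier] by metis
  then show ?thesis unfolding C_red_def by simp
qed

lemma C_red_carrier: "C_red \<in> carrier_mat n n"
  unfolding C_red_eq using Mb by (intro smult_carrier_mat mult_carrier_mat[of _ n n]) auto

lemma C_red_symmetric: "transpose_mat C_red = C_red"
  unfolding C_red_eq transpose_smult_mat
  by (rule arg_cong[of _ _ "smult_mat _"]) (rule congruence_symmetric[OF mat_diag_dim Mb], simp)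

lemma C_red_quadratic_form:
  assumes y: "y \<in> carrier_vec n"
  shows "y \<bullet> (C_red *\<^sub>v y) = 1 / \<alpha> * wsum (Mt_in y)"
proof -
  let ?D = "mat_diag n (\<lambda>i. if i \<in> \<I> then 1 / d i else 0)"
  have v: "transpose_mat Mb *\<^sub>v y \<in> carrier_vec n" using Mb y by auto
  have "y \<bullet> (C_red *\<^sub>v y) = 1 / \<alpha> * (y \<bullet> (Mb * ?D * transpose_mat Mb *\<^sub>v y))"
    unfolding C_red_eq using Mb y by (intro smult_quadratic_form mult_carrier_mat[of _ n n]) auto
  also have "y \<bullet> (Mb * ?D * transpose_mat Mb *\<^sub>v y) = wsum (Mt_in y)"
    unfolding congruence_quadratic_form[OF mat_diag_dim Mb y] mat_diag_quadratic_form[OF v] wsum_def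
      Mt_in_def Mt_def by (rule sum.cong) auto
  finally show ?thesis .
qed

text \<open>Evaluates \<open>r \<bullet> (c M)\<^sup>-\<^sup>1 r\<close>: this turns the vector \<open>t\<close> of \<open>saddle_point_eigenvector\<close> into coordinates of
  its right-hand side.\<close>

lemma M_solve:
  assumes t: "t \<in> carrier_vec n" and "c > 0" and r: "r \<in> carrier_vec n" and eq: "(c \<cdot>\<^sub>m M) *\<^sub>v t = r"
  shows "t \<bullet> ((c \<cdot>\<^sub>m M) *\<^sub>v t) = 1 / c * wsum (($) r)"
proof -
  have ri: "r $ i = c * (d i * t $ i)" if "i < n" for i
    using arg_cong[OF eq, of "\<lambda>v. v $ i"] that t
    by (simp add: smult_mat_mult_vec[OF M_carrier] del: index_mult_mat_vec) (simp add: M_def mat_diag_mult_vec)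
  have "t \<bullet> r = (\<Sum>i = 0..<n. 1 / c * (1 / d i * (r $ i)\<^sup>2))"
    unfolding scalar_prod_def using r
  proof (intro sum.cong)
    fix i assume "i \<in> {0..<n}"
    then show "t $ i * r $ i = 1 / c * (1 / d i * (r $ i)\<^sup>2)"
      using d_pos[of i] \<open>c > 0\<close> ri[of i] by (simp add: power2_eq_square field_simps)
  qed auto
  then show ?thesis unfolding eq wsum_def by (simp add: sum_distrib_left)
qed

text \<open>The eigenvalue \<open>1\<close> is an end point of the positive interval; every other one satisfies the scalar
  equation for \<open>f\<close>, \<open>g\<close>, \<open>h\<close>. The bound \<open>g \<le> (1 + \<zeta>)\<^sup>2 h\<close> is weakened to \<open>g \<le> \<xi> h\<close>, the one in terms of
  which the interval is stated.\<close>

theorem red_spectrum: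
  assumes \<xi>: "\<xi> = \<zeta>\<^sup>2 + (1 + \<zeta>)\<^sup>2"
    and ev: "z \<in> spectrum (map_mat complex_of_real (minv (P_red_BDF n \<alpha> L Mb M \<I>) * J_red n \<alpha> L Mb M \<I>))"
  shows "z \<in> complex_of_real ` ({(- \<xi> + 1 - sqrt ((\<xi> + 1)\<^sup>2 + 4 * \<zeta>\<^sup>2)) / 2 .. (1 - sqrt 3) / 2}
               \<union> {1 .. (1 + sqrt (1 + 4 * \<zeta>\<^sup>2)) / 2})"
proof (cases "z = 1")
  case True
  then show ?thesis by (intro image_eqI[of _ _ 1]) auto
next
  case False
  \<comment> \<open>A saddle point matrix with \<open>A = M\<close>, \<open>B = L\<close> and this \<open>S\<close>.\<close>
  let ?S = "(1 / \<alpha>) \<cdot>\<^sub>m SS_hat n \<alpha> L Mb M \<I>"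
  have S: "pos_def_mat n ?S"
    using SS_hat_pos_def \<alpha>_pos by (intro pos_def_mat_smult) auto
  obtain l y t where l: "z = complex_of_real l" "l \<noteq> 1" and y: "y \<in> carrier_vec n" "y \<bullet> (?S *\<^sub>v y) > 0"
    and t: "t \<in> carrier_vec n" "M *\<^sub>v t = transpose_mat L *\<^sub>v y"
    and eq: "t \<bullet> (M *\<^sub>v t) = (l - 1) * (l * (y \<bullet> (?S *\<^sub>v y)) + y \<bullet> (C_red *\<^sub>v y))"
    using preconditioned_saddle_point_eigenvalue[OF M_pos_def L C_red_carrier C_red_symmetric S _ False]
      ev unfolding P_red_BDF_def J_red_def C_red_def by blast
  define f g h where "f = wsum (\<lambda>i. sqrt \<alpha> * Lt y i)" and "g = wsum (Mt_in y)"
    and "h = wsum (\<lambda>i. sqrt \<alpha> * Lt y i + Mt_in y i)"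
  have S_form: "y \<bullet> (?S *\<^sub>v y) = 1 / \<alpha> * h"
    unfolding h_def SS_hat_quadratic_form[OF y(1), symmetric] using SS_hat_pos_def y
    by (intro smult_quadratic_form) (auto simp: pos_def_mat_def)
  have Lty: "transpose_mat L *\<^sub>v y \<in> carrier_vec n" using L y by auto
  have "1 \<cdot>\<^sub>m M = M" by (rule eq_matI) auto
  then have "t \<bullet> (M *\<^sub>v t) = wsum (Lt y)"
    using M_solve[OF t(1) _ Lty, of 1] t(2) unfolding Lt_def[abs_def] by simp
  moreover have "f = \<alpha> * wsum (Lt y)"
    unfolding f_def wsum_def using \<alpha>_pos by (simp add: power_mult_distrib sum_distrib_left ac_simps)
  ultimately have tf: "t \<bullet> (M *\<^sub>v t) = f / \<alpha>"
    using \<alpha>_pos by simp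
  have "f / \<alpha> = (l - 1) * (l * (h / \<alpha>) + g / \<alpha>)"
    using eq unfolding tf S_form C_red_quadratic_form[OF y(1)] g_def[symmetric] by simp
  then have "f = (l - 1) * (l * h + g)"
    using \<alpha>_pos by (simp add: field_simps)
  moreover have h: "h > 0"
    using y(2) \<alpha>_pos unfolding S_form by (simp add: zero_less_divide_iff)
  moreover have "g \<le> \<xi> * h"
  proof -
    have "g \<le> (1 + \<zeta>)\<^sup>2 * h"
      unfolding g_def h_def by (rule wsum_Mt_in_le[OF y(1)])
    also have "\<dots> \<le> \<xi> * h"
      using h unfolding \<xi> by (intro mult_right_mono) auto
    finally show ?thesis .
  qed
  moreover have "h \<le> 2 * (f + g)" "f \<le> \<zeta>\<^sup>2 * h" "f \<ge> 0" "g \<ge> 0"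
    unfolding f_def g_def h_def by (rule wsum_add_le wsum_Lt_le[OF y(1)] wsum_nonneg)+
  ultimately show ?thesis
    using red_eigenvalue_range[of f l h g \<zeta> \<xi>] l by blast
qed

definition U_corner where "U_corner = - (Mb * Pi_mat n \<A> * minv M * transpose_mat P)"

definition U where "U = four_block_mat (1\<^sub>m n) U_corner (0\<^sub>m k n) (1\<^sub>m k)"

definition S_core where "S_core = block_diag2 (SS_hat n \<alpha> L Mb M \<I>) (P * M * transpose_mat P)"

lemma S_hat_eq: "S_hat n \<alpha> L Mb M \<I> \<A> = (1 / \<alpha>) \<cdot>\<^sub>m (U * S_core * transpose_mat U)"
  unfolding S_hat_def Let_def U_def U_corner_def S_core_def P_def k_def ..

lemma U_corner_carrier: "U_corner \<in> carrier_mat n k"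
  unfolding U_corner_def minv_M using Mb P_carrier
  by (intro uminus_carrier_mat mult_carrier_mat[of _ n n] mult_carrier_mat[of _ n n]) auto

lemma U_carrier: "U \<in> carrier_mat (n + k) (n + k)"
  unfolding U_def by (intro four_block_carrier_mat) auto

lemma P_mult_transpose: "P * transpose_mat P = 1\<^sub>m k"
  and transpose_P_mult: "transpose_mat P * P = Pi_mat n \<A>"
  unfolding P_def k_def using active by (auto intro!: P_mat_mult_transpose transpose_P_mat_mult)

lemma transpose_U_mult_vec:
  assumes "y1 \<in> carrier_vec n" and "y2 \<in> carrier_vec k"
  shows "transpose_mat U *\<^sub>v (y1 @\<^sub>v y2) = y1 @\<^sub>v (transpose_mat U_corner *\<^sub>v y1 + y2)"
proof -
  have "transpose_mat U = four_block_mat (1\<^sub>m n) (0\<^sub>m n k) (transpose_mat U_corner) (1\<^sub>m k)"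
    unfolding U_def using U_corner_carrier by (subst transpose_four_block_mat[of _ n n _ k _ k]) auto
  then show ?thesis
    using four_block_mat_mult_vec[of "1\<^sub>m n" n n "0\<^sub>m n k" k "transpose_mat U_corner" k "1\<^sub>m k" y1 y2]
      assms U_corner_carrier by (simp add: zero_mat_mult_vec)
qed

lemma transpose_P_mult_injective:
  assumes "v \<in> carrier_vec k" and "transpose_mat P *\<^sub>v v = 0\<^sub>v n"
  shows "v = 0\<^sub>v k"
proof -
  have "v = P * transpose_mat P *\<^sub>v v"
    unfolding P_mult_transpose using assms by simp
  also have "\<dots> = P *\<^sub>v (transpose_mat P *\<^sub>v v)"
    using P_carrier assms by (intro assoc_mult_mat_vec) auto
  also have "\<dots> = 0\<^sub>v k"
    unfolding assms(2) using P_carrier by (intro eq_vecI) auto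
  finally show ?thesis .
qed

lemma PMP_pos_def: "pos_def_mat k (P * M * transpose_mat P)"
  using pos_def_mat_congruence[OF M_pos_def P_carrier] transpose_P_mult_injective by blast

lemma S_core_pos_def: "pos_def_mat (n + k) S_core"
  unfolding S_core_def by (rule pos_def_mat_block_diag2[OF SS_hat_pos_def PMP_pos_def])

lemma S_hat_pos_def: "pos_def_mat (n + k) (S_hat n \<alpha> L Mb M \<I> \<A>)"
  unfolding S_hat_eq
proof (rule pos_def_mat_smult[OF pos_def_mat_congruence[OF S_core_pos_def U_carrier]])
  fix v assume v: "v \<in> carrier_vec (n + k)" "transpose_mat U *\<^sub>v v = 0\<^sub>v (n + k)"
  obtain y1 y2 where y: "y1 \<in> carrier_vec n" "y2 \<in> carrier_vec k" "v = y1 @\<^sub>v y2"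
    using append_vec_cases[OF v(1)] .
  have z: "0\<^sub>v n @\<^sub>v 0\<^sub>v k = (0\<^sub>v (n + k) :: real vec)"
    by (rule eq_vecI) auto
  have "y1 @\<^sub>v (transpose_mat U_corner *\<^sub>v y1 + y2) = 0\<^sub>v n @\<^sub>v 0\<^sub>v k"
    using v(2) transpose_U_mult_vec[OF y(1,2)] unfolding y(3) z by simp
  then have y1: "y1 = 0\<^sub>v n" and "transpose_mat U_corner *\<^sub>v y1 + y2 = 0\<^sub>v k"
    using append_vec_eq[OF y(1), of "0\<^sub>v n"] by auto
  moreover have "transpose_mat U_corner *\<^sub>v 0\<^sub>v n = 0\<^sub>v k"
    using U_corner_carrier by (intro eq_vecI) auto
  ultimately have "y2 = 0\<^sub>v k" using y by simp
  with y1 show "v = 0\<^sub>v (n + k)" unfolding y(3) z[symmetric] by simp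
qed (use \<alpha>_pos in simp)

definition Pt :: "real vec \<Rightarrow> nat \<Rightarrow> real" where "Pt y i = (transpose_mat P *\<^sub>v y) $ i"

text \<open>By \<open>P P\<^sup>T = I\<close> and \<open>P\<^sup>T P = \<Pi>\<^sub>A\<close> the vector \<open>P\<^sup>T y\<close> is fixed by \<open>\<Pi>\<^sub>A\<close>.\<close>

lemma Pt_inactive:
  assumes y: "y \<in> carrier_vec k" and i: "i < n" "i \<notin> \<A>"
  shows "Pt y i = 0"
proof -
  let ?p = "transpose_mat P *\<^sub>v y"
  have p: "?p \<in> carrier_vec n" using P_carrier y by auto
  have Py: "P *\<^sub>v ?p = y"
    using assoc_mult_mat_vec[OF P_carrier transpose_carrier_mat[THEN iffD2, OF P_carrier] y]
    unfolding P_mult_transpose using y by simp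
  have "Pi_mat n \<A> *\<^sub>v ?p = ?p"
    using assoc_mult_mat_vec[OF transpose_carrier_mat[THEN iffD2, OF P_carrier] P_carrier p]
    unfolding transpose_P_mult Py .
  then have "?p $ i = (Pi_mat n \<A> *\<^sub>v ?p) $ i" by simp
  also have "\<dots> = 0"
    using i unfolding Pi_mat_def mat_diag_mult_vec[OF p] by simp
  finally show ?thesis unfolding Pt_def .
qed

lemma U_corner_mult_P:
  "U_corner * P = Mb * mat_diag n (\<lambda>i. if i \<in> \<A> then - 1 / d i else 0)"
proof -
  let ?D = "mat_diag n (\<lambda>i. 1 / d i)" and ?E = "mat_diag n (\<lambda>i. if i \<in> \<A> then 1 / d i else 0)"
  have Pt: "transpose_mat P \<in> carrier_mat n k" using P_carrier by simp
  have c: "Mb * Pi_mat n \<A> * ?D \<in> carrier_mat n n"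
    using Mb by (intro mult_carrier_mat[of _ n n]) auto
  have "U_corner * P = - (Mb * Pi_mat n \<A> * ?D * transpose_mat P * P)"
    unfolding U_corner_def minv_M using c Pt P_carrier
    by (intro uminus_mult_left_mat) auto
  also have "Mb * Pi_mat n \<A> * ?D * transpose_mat P * P = Mb * Pi_mat n \<A> * ?D * Pi_mat n \<A>"
    using assoc_mult_mat[OF c Pt P_carrier] unfolding transpose_P_mult .
  also have "\<dots> = Mb * (Pi_mat n \<A> * (?D * Pi_mat n \<A>))"
    using assoc_mult_mat[OF mult_carrier_mat[OF Mb Pi_carrier] mat_diag_dim Pi_carrier]
      assoc_mult_mat[OF Mb Pi_carrier mult_carrier_mat[OF mat_diag_dim Pi_carrier]] by metis
  also have "Pi_mat n \<A> * (?D * Pi_mat n \<A>) = ?E"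
    unfolding Pi_mat_def mat_diag_diag by (rule arg_cong[of _ _ "mat_diag n"]) auto
  also have "- (Mb * ?E) = Mb * (- ?E)"
    using Mb by (intro uminus_mult_right_mat[symmetric]) (auto simp: mat_diag_def)
  also have "- ?E = mat_diag n (\<lambda>i. if i \<in> \<A> then - 1 / d i else 0)"
    by (rule eq_matI) (auto simp: mat_diag_def)
  finally show ?thesis .
qed

text \<open>The vector \<open>X\<^sup>T y1 + y2\<close>, \<open>X\<close> the corner of \<open>U\<close>, is the second component of \<open>U\<^sup>T y\<close>. Embedded into the
  full space by \<open>P\<^sup>T\<close>, it is explicit in coordinates, because \<open>X P = - Mb \<Pi>\<^sub>A M\<^sup>-\<^sup>1\<close>.\<close>

lemma transpose_P_corner_index:
  assumes y: "y1 \<in> carrier_vec n" "y2 \<in> carrier_vec k" and i: "i < n"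
  shows "(transpose_mat P *\<^sub>v (transpose_mat U_corner *\<^sub>v y1 + y2)) $ i
    = Pt y2 i - (if i \<in> \<A> then Mt y1 i / d i else 0)"
proof -
  let ?G = "mat_diag n (\<lambda>i. if i \<in> \<A> then - 1 / d i else 0)"
  have c: "transpose_mat P \<in> carrier_mat n k" "transpose_mat U_corner \<in> carrier_mat k n"
    using P_carrier U_corner_carrier by auto
  have m: "transpose_mat Mb *\<^sub>v y1 \<in> carrier_vec n" using Mb y by auto
  have "transpose_mat P *\<^sub>v (transpose_mat U_corner *\<^sub>v y1)
      = (transpose_mat P * transpose_mat U_corner) *\<^sub>v y1"
    using assoc_mult_mat_vec[OF c y(1)] by simp
  also have "transpose_mat P * transpose_mat U_corner = ?G * transpose_mat Mb"
    using transpose_mult[OF U_corner_carrier P_carrier] transpose_mult[OF Mb mat_diag_dim]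
    unfolding U_corner_mult_P by simp
  also have "(?G * transpose_mat Mb) *\<^sub>v y1 = ?G *\<^sub>v (transpose_mat Mb *\<^sub>v y1)"
    using Mb y by (intro assoc_mult_mat_vec[of _ n n _ n]) auto
  also have "\<dots> = vec n (\<lambda>i. (if i \<in> \<A> then - 1 / d i else 0) * Mt y1 i)"
    unfolding mat_diag_mult_vec[OF m] Mt_def ..
  finally have "(transpose_mat P *\<^sub>v (transpose_mat U_corner *\<^sub>v y1)) $ i
      = (if i \<in> \<A> then - 1 / d i else 0) * Mt y1 i"
    using i by simp
  moreover have "transpose_mat P *\<^sub>v (transpose_mat U_corner *\<^sub>v y1 + y2)
      = transpose_mat P *\<^sub>v (transpose_mat U_corner *\<^sub>v y1) + transpose_mat P *\<^sub>v y2"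
    using c y by (intro mult_add_distrib_mat_vec) auto
  ultimately show ?thesis
    using i P_carrier unfolding Pt_def by (simp del: index_mult_mat_vec)
qed

text \<open>As \<open>U\<^sup>T y\<close> has the components \<open>y1\<close> and \<open>X\<^sup>T y1 + y2\<close>, the two blocks of the core of \<open>S_hat\<close> contribute
  one sum each. In the second one \<open>P\<^sup>T\<close> moves the sum over the active indices to all indices, where the
  terms off \<open>\<A>\<close> vanish.\<close>

lemma S_hat_quadratic_form:
  assumes y: "y1 \<in> carrier_vec n" "y2 \<in> carrier_vec k"
  shows "(y1 @\<^sub>v y2) \<bullet> (S_hat n \<alpha> L Mb M \<I> \<A> *\<^sub>v (y1 @\<^sub>v y2))
    = 1 / \<alpha> * (wsum (\<lambda>i. sqrt \<alpha> * Lt y1 i + Mt_in y1 i)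
        + (\<Sum>i = 0..<n. d i * (Pt y2 i - (if i \<in> \<A> then Mt y1 i / d i else 0))\<^sup>2))"
proof -
  let ?y = "y1 @\<^sub>v y2" and ?w = "transpose_mat U_corner *\<^sub>v y1 + y2"
  have yc: "?y \<in> carrier_vec (n + k)" using y by simp
  have w: "?w \<in> carrier_vec k" using U_corner_carrier y by auto
  have Pw: "transpose_mat P *\<^sub>v ?w \<in> carrier_vec n" using P_carrier w by auto
  have Ic: "S_core \<in> carrier_mat (n + k) (n + k)"
    and Sc: "SS_hat n \<alpha> L Mb M \<I> \<in> carrier_mat n n"
    and Dc: "P * M * transpose_mat P \<in> carrier_mat k k"
    using S_core_pos_def SS_hat_pos_def PMP_pos_def unfolding pos_def_mat_def by auto
  have "?y \<bullet> (S_hat n \<alpha> L Mb M \<I> \<A> *\<^sub>v ?y) = 1 / \<alpha> * (?y \<bullet> (U * S_core * transpose_mat U *\<^sub>v ?y))"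
    unfolding S_hat_eq using yc U_carrier Ic
    by (intro smult_quadratic_form mult_carrier_mat[of _ "n + k" "n + k"]) auto
  also have "?y \<bullet> (U * S_core * transpose_mat U *\<^sub>v ?y)
      = y1 \<bullet> (SS_hat n \<alpha> L Mb M \<I> *\<^sub>v y1) + ?w \<bullet> (P * M * transpose_mat P *\<^sub>v ?w)"
    unfolding congruence_quadratic_form[OF Ic U_carrier yc] transpose_U_mult_vec[OF y]
    unfolding S_core_def by (rule block_diag2_quadratic_form[OF Sc Dc y(1) w])
  also have "?w \<bullet> (P * M * transpose_mat P *\<^sub>v ?w)
      = (\<Sum>i = 0..<n. d i * ((transpose_mat P *\<^sub>v ?w) $ i)\<^sup>2)"
    unfolding congruence_quadratic_form[OF M_carrier P_carrier w] unfolding M_def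
    by (rule mat_diag_quadratic_form[OF Pw])
  also have "\<dots> = (\<Sum>i = 0..<n. d i * (Pt y2 i - (if i \<in> \<A> then Mt y1 i / d i else 0))\<^sup>2)"
    using transpose_P_corner_index[OF y] by (simp del: index_mult_mat_vec)
  finally show ?thesis
    unfolding SS_hat_quadratic_form[OF y(1)] .
qed

definition B_aug where "B_aug = four_block_mat L (- Mb) (0\<^sub>m k n) (P * M)"

lemma B_aug_carrier: "B_aug \<in> carrier_mat (n + k) (n + n)"
  unfolding B_aug_def using L P_carrier M_carrier by (intro four_block_carrier_mat) auto

lemma transpose_B_aug:
  "transpose_mat B_aug
    = four_block_mat (transpose_mat L) (0\<^sub>m n k) (- transpose_mat Mb) (M * transpose_mat P)"
proof -
  have "transpose_mat (P * M) = M * transpose_mat P"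
    using transpose_mult[OF P_carrier M_carrier] M_pos_def unfolding pos_def_mat_def by simp
  then show ?thesis
    unfolding B_aug_def using L Mb P_carrier M_carrier
    by (subst transpose_four_block_mat[of _ n n _ n _ k]) (auto simp: transpose_uminus)
qed

lemma J_aug_eq:
  "J_aug n \<alpha> L Mb M \<A>
    = four_block_mat (J11 \<alpha> M) (transpose_mat B_aug) B_aug (- 0\<^sub>m (n + k) (n + k))"
proof -
  have "four_block_mat (0\<^sub>m n n) (0\<^sub>m n k) (0\<^sub>m k n) (0\<^sub>m k k) = (- 0\<^sub>m (n + k) (n + k) :: real mat)"
    by (rule eq_matI) auto
  moreover have "J11 \<alpha> M = four_block_mat M (0\<^sub>m n n) (0\<^sub>m n n) (\<alpha> \<cdot>\<^sub>m M)"
    unfolding J11_def block_diag2_def using M_carrier by auto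
  ultimately show ?thesis
    unfolding transpose_B_aug unfolding J_aug_def B_aug_def P_def k_def by simp
qed

lemma J11_pos_def: "pos_def_mat (n + n) (J11 \<alpha> M)"
  unfolding J11_def by (intro pos_def_mat_block_diag2 pos_def_mat_smult M_pos_def \<alpha>_pos)

text \<open>The form of the Schur complement \<open>B J11\<^sup>-\<^sup>1 B\<^sup>T\<close>. Its second part is the weighted square sum of
  \<open>M P\<^sup>T y2 - Mb\<^sup>T y1\<close>, which splits along the index sets: on \<open>\<I>\<close> only \<open>Mb\<^sup>T y1\<close> is left, and on \<open>\<A>\<close> there
  remains exactly the term that also occurs in \<open>S_hat_quadratic_form\<close>.\<close>

lemma aug_schur_complement_form:
  assumes y: "y1 \<in> carrier_vec n" "y2 \<in> carrier_vec k" and t: "t \<in> carrier_vec (n + n)"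
    and eq: "J11 \<alpha> M *\<^sub>v t = transpose_mat B_aug *\<^sub>v (y1 @\<^sub>v y2)"
  shows "t \<bullet> (J11 \<alpha> M *\<^sub>v t)
    = 1 / \<alpha> * (wsum (\<lambda>i. sqrt \<alpha> * Lt y1 i) + wsum (Mt_in y1)
        + (\<Sum>i = 0..<n. d i * (Pt y2 i - (if i \<in> \<A> then Mt y1 i / d i else 0))\<^sup>2))"
proof -
  obtain t1 t2 where tt: "t1 \<in> carrier_vec n" "t2 \<in> carrier_vec n" "t = t1 @\<^sub>v t2"
    using append_vec_cases[OF t] .
  have aM: "\<alpha> \<cdot>\<^sub>m M \<in> carrier_mat n n" using M_carrier by simp
  have c: "transpose_mat L \<in> carrier_mat n n" "- transpose_mat Mb \<in> carrier_mat n n"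
    "M * transpose_mat P \<in> carrier_mat n k"
    using L Mb M_carrier P_carrier by auto
  let ?r = "- transpose_mat Mb *\<^sub>v y1 + M * transpose_mat P *\<^sub>v y2"
  have r: "?r \<in> carrier_vec n"
    using c y by (intro add_carrier_vec mult_mat_vec_carrier) auto
  have l: "transpose_mat L *\<^sub>v y1 \<in> carrier_vec n" using c y by auto
  have "(M *\<^sub>v t1) @\<^sub>v ((\<alpha> \<cdot>\<^sub>m M) *\<^sub>v t2) = (transpose_mat L *\<^sub>v y1 + 0\<^sub>m n k *\<^sub>v y2) @\<^sub>v ?r"
    using eq unfolding tt(3) J11_def block_diag2_mult_vec[OF M_carrier aM tt(1,2)] transpose_B_aug
      four_block_mat_mult_vec[OF c(1) zero_carrier_mat c(2,3) y] .
  moreover have "transpose_mat L *\<^sub>v y1 + 0\<^sub>m n k *\<^sub>v y2 = transpose_mat L *\<^sub>v y1"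
    using l y by (simp add: zero_mat_mult_vec)
  ultimately have t1: "M *\<^sub>v t1 = transpose_mat L *\<^sub>v y1" and t2: "(\<alpha> \<cdot>\<^sub>m M) *\<^sub>v t2 = ?r"
    using append_vec_eq[of "M *\<^sub>v t1" n "transpose_mat L *\<^sub>v y1"] M_carrier tt(1) l by auto
  have "1 \<cdot>\<^sub>m M = M" by (rule eq_matI) auto
  then have q1: "t1 \<bullet> (M *\<^sub>v t1) = wsum (Lt y1)"
    using M_solve[OF tt(1) _ l, of 1] t1 unfolding Lt_def[abs_def] by simp
  have q2: "t2 \<bullet> ((\<alpha> \<cdot>\<^sub>m M) *\<^sub>v t2) = 1 / \<alpha> * wsum (($) ?r)"
    by (rule M_solve[OF tt(2) \<alpha>_pos r t2])
  have ri: "?r $ i = d i * Pt y2 i - Mt y1 i" if "i < n" for i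
  proof -
    have p: "transpose_mat P *\<^sub>v y2 \<in> carrier_vec n" using P_carrier y by auto
    have "M * transpose_mat P *\<^sub>v y2 = M *\<^sub>v (transpose_mat P *\<^sub>v y2)"
      using M_carrier P_carrier y by (intro assoc_mult_mat_vec) auto
    also have "\<dots> = vec n (\<lambda>i. d i * Pt y2 i)"
      unfolding M_def Pt_def by (rule mat_diag_mult_vec[OF p])
    finally have "M * transpose_mat P *\<^sub>v y2 = vec n (\<lambda>i. d i * Pt y2 i)" .
    moreover have "- transpose_mat Mb *\<^sub>v y1 = - (transpose_mat Mb *\<^sub>v y1)"
      using Mb y by simp
    ultimately show ?thesis
      using that Mb unfolding Mt_def by (simp del: index_mult_mat_vec)
  qed
  have "wsum (($) ?r) = wsum (Mt_in y1)
      + (\<Sum>i = 0..<n. d i * (Pt y2 i - (if i \<in> \<A> then Mt y1 i / d i else 0))\<^sup>2)"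
    unfolding wsum_def sum.distrib[symmetric]
  proof (rule sum.cong)
    fix i assume "i \<in> {0..<n}"
    then have i: "i < n" by simp
    show "1 / d i * (?r $ i)\<^sup>2 = 1 / d i * (Mt_in y1 i)\<^sup>2
        + d i * (Pt y2 i - (if i \<in> \<A> then Mt y1 i / d i else 0))\<^sup>2"
    proof (cases "i \<in> \<A>")
      case True
      then have "Mt_in y1 i = 0" unfolding Mt_in_def using active by simp
      then show ?thesis
        using True d_pos[OF i] unfolding ri[OF i] by (simp add: power2_eq_square field_simps)
    next
      case False
      then have "Mt_in y1 i = Mt y1 i" unfolding Mt_in_def using active i by simp
      then show ?thesis
        using False Pt_inactive[OF y(2) i False] unfolding ri[OF i] by simp
    qed
  qed simp
  moreover have "wsum (\<lambda>i. sqrt \<alpha> * Lt y1 i) = \<alpha> * wsum (Lt y1)"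
    unfolding wsum_def using \<alpha>_pos by (simp add: power_mult_distrib sum_distrib_left ac_simps)
  moreover have "t \<bullet> (J11 \<alpha> M *\<^sub>v t) = t1 \<bullet> (M *\<^sub>v t1) + t2 \<bullet> ((\<alpha> \<cdot>\<^sub>m M) *\<^sub>v t2)"
    unfolding tt(3) J11_def by (rule block_diag2_quadratic_form[OF M_carrier aM tt(1,2)])
  ultimately show ?thesis
    unfolding q1 q2 using \<alpha>_pos by (simp add: field_simps)
qed

text \<open>With \<open>C = 0\<close> the scalar equation says that \<open>l (l - 1)\<close> is the quotient of \<open>f + g + w\<close> and \<open>h + w\<close>. The
  common term \<open>w\<close>, which comes from the active indices, pulls this quotient towards \<open>1\<close>, which
  keeps it in \<open>[1/2, \<xi>]\<close> because \<open>\<xi> \<ge> 1\<close>.\<close>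

theorem aug_spectrum:
  assumes \<xi>: "\<xi> = \<zeta>\<^sup>2 + (1 + \<zeta>)\<^sup>2"
    and ev: "z \<in> spectrum (map_mat complex_of_real (minv (P_aug_BDF n \<alpha> L Mb M \<I> \<A>) * J_aug n \<alpha> L Mb M \<A>))"
  shows "z \<in> complex_of_real ` ({(1 - sqrt (1 + 4 * \<xi>)) / 2 .. (1 - sqrt 3) / 2}
               \<union> {1 .. (1 + sqrt (1 + 4 * \<xi>)) / 2})"
proof (cases "z = 1")
  case True
  have "\<xi> \<ge> 0" unfolding \<xi> by simp
  with True show ?thesis by (intro image_eqI[of _ _ 1]) auto
next
  case False
  let ?S = "S_hat n \<alpha> L Mb M \<I> \<A>" and ?O = "0\<^sub>m (n + k) (n + k) :: real mat"
  obtain l y t where l: "z = complex_of_real l"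
    and y: "y \<in> carrier_vec (n + k)" "y \<bullet> (?S *\<^sub>v y) > 0"
    and t: "t \<in> carrier_vec (n + n)" "J11 \<alpha> M *\<^sub>v t = transpose_mat B_aug *\<^sub>v y"
    and eq: "t \<bullet> (J11 \<alpha> M *\<^sub>v t) = (l - 1) * (l * (y \<bullet> (?S *\<^sub>v y)) + y \<bullet> (?O *\<^sub>v y))"
    using preconditioned_saddle_point_eigenvalue[OF J11_pos_def B_aug_carrier zero_carrier_mat
        zero_transpose_mat S_hat_pos_def _ False] ev
    unfolding P_aug_BDF_def J_aug_eq by blast
  obtain y1 y2 where yy: "y1 \<in> carrier_vec n" "y2 \<in> carrier_vec k" "y = y1 @\<^sub>v y2"
    using append_vec_cases[OF y(1)] .
  define f g h w where "f = wsum (\<lambda>i. sqrt \<alpha> * Lt y1 i)" and "g = wsum (Mt_in y1)"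
    and "h = wsum (\<lambda>i. sqrt \<alpha> * Lt y1 i + Mt_in y1 i)"
    and "w = (\<Sum>i = 0..<n. d i * (Pt y2 i - (if i \<in> \<A> then Mt y1 i / d i else 0))\<^sup>2)"
  have S_form: "y \<bullet> (?S *\<^sub>v y) = 1 / \<alpha> * (h + w)"
    unfolding yy(3) h_def w_def by (rule S_hat_quadratic_form[OF yy(1,2)])
  have "t \<bullet> (J11 \<alpha> M *\<^sub>v t) = 1 / \<alpha> * (f + g + w)"
    unfolding f_def g_def w_def by (rule aug_schur_complement_form[OF yy(1,2) t[unfolded yy(3)]])
  moreover have "y \<bullet> (?O *\<^sub>v y) = 0"
    using y by (simp add: zero_mat_mult_vec)
  ultimately have "1 / \<alpha> * (f + g + w) = (l - 1) * (l * (1 / \<alpha> * (h + w)) + 0)"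
    using eq unfolding S_form by metis
  then have eq': "f + g + w = l * (l - 1) * (h + w)"
    using \<alpha>_pos by (simp add: field_simps)
  have hw: "h + w > 0"
    using y(2) \<alpha>_pos unfolding S_form by (simp add: zero_less_divide_iff)
  have w: "w \<ge> 0"
    unfolding w_def using d_pos by (intro sum_nonneg) (simp add: less_imp_le)
  have "h \<le> 2 * (f + g)" and f: "f \<le> \<zeta>\<^sup>2 * h" and g: "g \<le> (1 + \<zeta>)\<^sup>2 * h"
    unfolding f_def g_def h_def
    by (rule wsum_add_le wsum_Lt_le[OF yy(1)] wsum_Mt_in_le[OF yy(1)])+
  then have "1 / 2 * (h + w) \<le> l * (l - 1) * (h + w)"
    unfolding eq'[symmetric] using w by simp
  moreover have "l * (l - 1) * (h + w) \<le> \<xi> * (h + w)"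
  proof -
    have "\<zeta> \<ge> 0" unfolding \<zeta>_def by (rule spectral_norm_nonneg)
    then have "1 \<le> \<xi>" unfolding \<xi> by (simp add: power2_eq_square algebra_simps)
    \<comment> \<open>This is where \<open>\<xi> \<ge> 1\<close> matters: \<open>\<xi>\<close> must also bound the quotient \<open>1\<close> that belongs to \<open>w\<close>.\<close>
    then have "1 * w \<le> \<xi> * w" using w by (intro mult_right_mono)
    moreover have "f + g \<le> \<xi> * h"
      using add_mono[OF f g] unfolding \<xi> by (simp add: algebra_simps)
    ultimately show ?thesis
      unfolding eq'[symmetric] by (simp add: algebra_simps)
  qed
  ultimately have "1 / 2 \<le> l * (l - 1)" "l * (l - 1) \<le> \<xi>"
    using hw by (simp_all only: mult_le_cancel_right_pos)
  then show ?thesis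
    unfolding l by (intro imageI aug_eigenvalue_range)
qed

end


section \<open>Eigenvalue intervals of the preconditioned optimality systems\<close>

theorem theorem4p4:
  fixes n :: nat and L Mb M :: "real mat" and \<I> \<A> :: "nat set" and \<alpha> \<zeta> \<xi> :: real
  assumes "n \<ge> 1"
    and "L \<in> carrier_mat n n" and "Mb \<in> carrier_mat n n" and "M \<in> carrier_mat n n"
    and "diagonal_mat M" and "\<And>i. i < n \<Longrightarrow> M $$ (i, i) > 0"
    and "\<I> \<subseteq> {0..<n}" and "\<A> = {0..<n} - \<I>"
    and "\<alpha> > 0"
    and "invertible_mat (sqrt \<alpha> \<cdot>\<^sub>m L + Mb * Pi_mat n \<I>)"
    and "\<zeta> = spectral_norm
           (diag_sqrt M * minv (sqrt \<alpha> \<cdot>\<^sub>m L + Mb * Pi_mat n \<I>) *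
             (sqrt \<alpha> \<cdot>\<^sub>m L) * minv (diag_sqrt M))"
    and "\<xi> = \<zeta>\<^sup>2 + (1 + \<zeta>)\<^sup>2"
  shows "spectrum (map_mat complex_of_real
            (minv (P_aug_BDF n \<alpha> L Mb M \<I> \<A>) * J_aug n \<alpha> L Mb M \<A>))
          \<subseteq> complex_of_real `
              ({(1 - sqrt (1 + 4 * \<xi>)) / 2 .. (1 - sqrt 3) / 2}
               \<union> {1 .. (1 + sqrt (1 + 4 * \<xi>)) / 2})
       \<and>
         spectrum (map_mat complex_of_real
            (minv (P_red_BDF n \<alpha> L Mb M \<I>) * J_red n \<alpha> L Mb M \<I>))
          \<subseteq> complex_of_real `
              ({(- \<xi> + 1 - sqrt ((\<xi> + 1)\<^sup>2 + 4 * \<zeta>\<^sup>2)) / 2 .. (1 - sqrt 3) / 2}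
               \<union> {1 .. (1 + sqrt (1 + 4 * \<zeta>\<^sup>2)) / 2})"
proof -
  define d where "d i = M $$ (i, i)" for i
  interpret S: optimality_system n L Mb d \<I> \<A> \<alpha>
  proof
    have "sqrt \<alpha> \<cdot>\<^sub>m L + Mb * Pi_mat n \<I> \<in> carrier_mat n n"
      using assms(2,3) by (auto simp: Pi_mat_def)
    then show "det (sqrt \<alpha> \<cdot>\<^sub>m L + Mb * Pi_mat n \<I>) \<noteq> 0"
      using assms(10) by (rule invertible_mat_det_nonzero)
  qed (use assms in \<open>auto simp: d_def\<close>)
  have M: "S.M = M"
    unfolding S.M_def unfolding d_def[abs_def]
    by (rule diagonal_mat_eq_mat_diag[OF assms(4,5), symmetric])
  have z: "S.\<zeta> = \<zeta>"
    unfolding S.\<zeta>_def S.W_def M assms(11) ..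
  show ?thesis
    using S.aug_spectrum S.red_spectrum assms(12) unfolding M z by blast
qed

end
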